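(* Let $H$ be a finite-dimensional unimodular Hopf algebra over a field $\Bbbk$, let $N$ be the subalgebra of $H$ generated by all commutators $\{a,b\}$, $a,b\in H$ (a normal left coideal subalgebra of $H$), and let $N^+=N\cap\ker\varepsilon$. Then the Hopf quotient $H/HN^{+}$ is commutative.
   Context: Sweedler notation: $\Delta(a)=a_1\otimes a_2$; $S$ is the antipode, $\varepsilon$ the counit. $H$ is unimodular if its left integrals are also right integrals. A right integral of $H^*$ is $\lambda\in H^*$ with $\lambda(a_1)a_2=\lambda(a)1$ for all $a\in H$. The distinguished group-like element $g\in H$ is determined by $a_1\lambda(a_2)=\lambda(a)g$ for all $a\in H$ (for $\lambda$ a nonzero right integral of $H^*$); for unimodular $H$ one has $S^4(a)=gag^{-1}$. The commutator of $a,b\in H$ is $\{a,b\}:=a_1S^2(b_1)S(a_2)S^{-1}(b_2)g^{-1}$. A left coideal subalgebra is a subalgebra $N$ with $\Delta(N)\subseteq H\otimes N$; it is normal if $h_1xS(h_2)\in N$ for all $h\in H$, $x\in N$. For such $N$, $HN^+$ is a Hopf ideal of $H$. *)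

theory Defs
  imports HOL.Vector_Spaces "HOL-Library.Poly_Mapping" "HOL-Algebra.QuotRing"
begin

section \<open>Tensors\<close>

text \<open>
  The tensor product of vector spaces is the free vector space on the set of pairs (triples)
  modulo the subspace spanned by the multilinearity relations. A tensor
  \<open>x\<^sub>1 \<otimes> y\<^sub>1 + \<dots> + x\<^sub>n \<otimes> y\<^sub>n\<close> is written as the list \<open>[(x\<^sub>1, y\<^sub>1), \<dots>, (x\<^sub>n, y\<^sub>n)]\<close>, every
  element of the tensor product being of this form; addition of tensors is list concatenation.
  Two lists denote the same tensor iff their formal sums agree in the quotient space
  (\<open>tensor_eq\<close>, \<open>tensor3_eq\<close>).
\<close>

definition free_scale :: "'k::field \<Rightarrow> ('i \<Rightarrow>\<^sub>0 'k) \<Rightarrow> ('i \<Rightarrow>\<^sub>0 'k)" where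
  "free_scale c f = Poly_Mapping.map (\<lambda>x. c * x) f"

lemma lookup_free_scale [simp]:
  "Poly_Mapping.lookup (free_scale c f) i = c * Poly_Mapping.lookup f i"
  by (simp add: free_scale_def Poly_Mapping.map.rep_eq when_def)

lemma vector_space_free_scale: "vector_space (free_scale :: 'k::field \<Rightarrow> ('i \<Rightarrow>\<^sub>0 'k) \<Rightarrow> _)"
  by unfold_locales (auto intro!: poly_mapping_eqI simp: lookup_add algebra_simps)

definition formal_sum :: "'i list \<Rightarrow> ('i \<Rightarrow>\<^sub>0 'k::field)" where
  "formal_sum ts = (\<Sum>t\<leftarrow>ts. Poly_Mapping.single t 1)"

context vector_space
begin

abbreviation pure :: "'i \<Rightarrow> ('i \<Rightarrow>\<^sub>0 'a)" where
  "pure t \<equiv> Poly_Mapping.single t 1"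

definition tensor_relations :: "('b \<times> 'b \<Rightarrow>\<^sub>0 'a) set" where
  "tensor_relations =
     {pure (x + x', y) - pure (x, y) - pure (x', y) | x x' y. True} \<union>
     {pure (x, y + y') - pure (x, y) - pure (x, y') | x y y'. True} \<union>
     {pure (scale c x, y) - free_scale c (pure (x, y)) | c x y. True} \<union>
     {pure (x, scale c y) - free_scale c (pure (x, y)) | c x y. True}"

definition tensor_eq :: "('b \<times> 'b) list \<Rightarrow> ('b \<times> 'b) list \<Rightarrow> bool" where
  "tensor_eq ts us \<longleftrightarrow>
     formal_sum ts - formal_sum us \<in> module.span free_scale tensor_relations"

definition tensor3_relations :: "('b \<times> 'b \<times> 'b \<Rightarrow>\<^sub>0 'a) set" where
  "tensor3_relations =
     {pure (x + x', y, z) - pure (x, y, z) - pure (x', y, z) | x x' y z. True} \<union>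
     {pure (x, y + y', z) - pure (x, y, z) - pure (x, y', z) | x y y' z. True} \<union>
     {pure (x, y, z + z') - pure (x, y, z) - pure (x, y, z') | x y z z'. True} \<union>
     {pure (scale c x, y, z) - free_scale c (pure (x, y, z)) | c x y z. True} \<union>
     {pure (x, scale c y, z) - free_scale c (pure (x, y, z)) | c x y z. True} \<union>
     {pure (x, y, scale c z) - free_scale c (pure (x, y, z)) | c x y z. True}"

definition tensor3_eq :: "('b \<times> 'b \<times> 'b) list \<Rightarrow> ('b \<times> 'b \<times> 'b) list \<Rightarrow> bool" where
  "tensor3_eq ts us \<longleftrightarrow>
     formal_sum ts - formal_sum us \<in> module.span free_scale tensor3_relations"

end

section \<open>Hopf algebras\<close>

text \<open>
  \<open>comult a\<close> is a list representing the tensor \<open>\<Delta>(a) = a\<^sub>1 \<otimes> a\<^sub>2\<close>; all laws about \<open>\<Delta>\<close> are equalities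
  of tensors. A Sweedler expression \<open>f(a\<^sub>1, a\<^sub>2)\<close> with \<open>f\<close> bilinear is
  \<open>\<Sum>(x, y)\<leftarrow>comult a. f x y\<close>, which does not depend on the representing list.
\<close>

locale hopf_algebra = vector_space scale
  for scale :: "'k::field \<Rightarrow> 'h::ring_1 \<Rightarrow> 'h" +
  fixes comult :: "'h \<Rightarrow> ('h \<times> 'h) list"
    and counit :: "'h \<Rightarrow> 'k"
    and antipode :: "'h \<Rightarrow> 'h"
  assumes scale_mult_left: "scale c (a * b) = scale c a * b"
    and scale_mult_right: "scale c (a * b) = a * scale c b"
    and comult_add: "tensor_eq (comult (a + b)) (comult a @ comult b)"
    and comult_scale: "tensor_eq (comult (scale c a)) [(scale c x, y). (x, y) \<leftarrow> comult a]"
    and coassoc: "tensor3_eq [(u, v, y). (x, y) \<leftarrow> comult a, (u, v) \<leftarrow> comult x]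
                             [(x, u, v). (x, y) \<leftarrow> comult a, (u, v) \<leftarrow> comult y]"
    and counit_linear: "Vector_Spaces.linear scale (*) counit"
    and counit_left: "(\<Sum>(x, y)\<leftarrow>comult a. scale (counit x) y) = a"
    and counit_right: "(\<Sum>(x, y)\<leftarrow>comult a. scale (counit y) x) = a"
    and comult_one: "tensor_eq (comult 1) [(1, 1)]"
    and comult_mult: "tensor_eq (comult (a * b))
                        [(x * x', y * y'). (x, y) \<leftarrow> comult a, (x', y') \<leftarrow> comult b]"
    and counit_one: "counit 1 = 1"
    and counit_mult: "counit (a * b) = counit a * counit b"
    and antipode_linear: "Vector_Spaces.linear scale scale antipode"
    and antipode_left: "(\<Sum>(x, y)\<leftarrow>comult a. antipode x * y) = scale (counit a) 1"
    and antipode_right: "(\<Sum>(x, y)\<leftarrow>comult a. x * antipode y) = scale (counit a) 1"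
begin

definition finite_dimensional :: bool where
  "finite_dimensional \<longleftrightarrow> (\<exists>B. finite B \<and> span B = UNIV)"

definition left_integral :: "'h \<Rightarrow> bool" where
  "left_integral \<Lambda> \<longleftrightarrow> (\<forall>h. h * \<Lambda> = scale (counit h) \<Lambda>)"

definition right_integral :: "'h \<Rightarrow> bool" where
  "right_integral \<Lambda> \<longleftrightarrow> (\<forall>h. \<Lambda> * h = scale (counit h) \<Lambda>)"

definition unimodular :: bool where
  "unimodular \<longleftrightarrow> (\<forall>\<Lambda>. left_integral \<Lambda> \<longrightarrow> right_integral \<Lambda>)"

definition dual_right_integral :: "('h \<Rightarrow> 'k) \<Rightarrow> bool" where
  "dual_right_integral l \<longleftrightarrow> Vector_Spaces.linear scale (*) l \<and>
     (\<forall>a. (\<Sum>(x, y)\<leftarrow>comult a. scale (l x) y) = scale (l a) 1)"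

definition distinguished_grouplike :: "'h \<Rightarrow> bool" where
  "distinguished_grouplike g \<longleftrightarrow>
     (\<exists>l. dual_right_integral l \<and> (\<exists>a. l a \<noteq> 0) \<and>
        (\<forall>a. (\<Sum>(x, y)\<leftarrow>comult a. scale (l y) x) = scale (l a) g))"

definition alg_inverse :: "'h \<Rightarrow> 'h" where
  "alg_inverse a = (THE b. a * b = 1 \<and> b * a = 1)"

text \<open>
  The inverse \<open>S\<^sup>-\<^sup>1\<close> is the inverse function of the antipode, which is bijective in finite
  dimension.
\<close>

definition commutator :: "'h \<Rightarrow> 'h \<Rightarrow> 'h \<Rightarrow> 'h" where
  "commutator g a b =
     (\<Sum>(a1, a2)\<leftarrow>comult a. \<Sum>(b1, b2)\<leftarrow>comult b.
        a1 * antipode (antipode b1) * antipode a2 * inv_into UNIV antipode b2 * alg_inverse g)"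

definition subalgebra :: "'h set \<Rightarrow> bool" where
  "subalgebra N \<longleftrightarrow> subspace N \<and> 1 \<in> N \<and> (\<forall>x\<in>N. \<forall>y\<in>N. x * y \<in> N)"

definition left_coideal_subalgebra :: "'h set \<Rightarrow> bool" where
  "left_coideal_subalgebra N \<longleftrightarrow> subalgebra N \<and>
     (\<forall>x\<in>N. \<exists>ts. set ts \<subseteq> UNIV \<times> N \<and> tensor_eq (comult x) ts)"

definition normal_left_coideal_subalgebra :: "'h set \<Rightarrow> bool" where
  "normal_left_coideal_subalgebra N \<longleftrightarrow> left_coideal_subalgebra N \<and>
     (\<forall>h. \<forall>x\<in>N. (\<Sum>(h1, h2)\<leftarrow>comult h. h1 * x * antipode h2) \<in> N)"

definition commutator_subalgebra :: "'h \<Rightarrow> 'h set" where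
  "commutator_subalgebra g = subalgebra hull {commutator g a b | a b. True}"

text \<open>The left ideal \<open>HN\<^sup>+\<close>, where \<open>N\<^sup>+ = N \<inter> ker \<epsilon>\<close>.\<close>

definition left_ideal_plus :: "'h set \<Rightarrow> 'h set" where
  "left_ideal_plus N = span {h * n | h n. n \<in> N \<and> counit n = 0}"

definition underlying_ring :: "'h ring" where
  "underlying_ring = \<lparr>carrier = UNIV, monoid.mult = (*), one = 1, zero = 0, add = (+)\<rparr>"

definition hopf_ideal :: "'h set \<Rightarrow> bool" where
  "hopf_ideal I \<longleftrightarrow> ideal I underlying_ring \<and> subspace I \<and>
     (\<forall>x\<in>I. counit x = 0) \<and>
     (\<forall>x\<in>I. \<exists>ts us. set ts \<subseteq> I \<times> UNIV \<and> set us \<subseteq> UNIV \<times> I \<and>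
        tensor_eq (comult x) (ts @ us)) \<and>
     (\<forall>x\<in>I. antipode x \<in> I)"

end

end

theory Submission
  imports Defs
begin

text \<open>
  Commutativity of \<open>H/I\<close>, \<open>I = HN\<^sup>+\<close>, is almost built into the definition of the commutators. An
  element \<open>x\<close> of \<open>N\<close> is congruent to \<open>\<epsilon>(x)1\<close> modulo \<open>I\<close>, and \<open>g\<close> and all \<open>{a, b}\<close> lie in \<open>N\<close>; so
  \<open>a\<^sub>1S\<^sup>2(b\<^sub>1)S(a\<^sub>2)S\<^sup>-\<^sup>1(b\<^sub>2)\<close> is congruent to \<open>\<epsilon>(a)\<epsilon>(b)1\<close>. Multiplying by \<open>S\<^sup>-\<^sup>2(b\<^sub>3)a\<^sub>3\<close> cancels the
  last factors and gives \<open>aS\<^sup>2(b) \<equiv> S\<^sup>-\<^sup>2(b)a\<close>, and \<open>S\<^sup>-\<^sup>2(b) \<equiv> S\<^sup>2(b)\<close> because \<open>S\<^sup>4\<close> is conjugation by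
  \<open>g\<close> and \<open>g \<equiv> 1\<close> (\<open>commute_mod_left_ideal_plus\<close>).

  That \<open>N\<close> is a left coideal follows from
  \<open>\<Delta>{a, b} = a\<^sub>1S\<^sup>2(b\<^sub>1)S(a\<^sub>3)S\<^sup>-\<^sup>1(b\<^sub>3)g\<^sup>-\<^sup>1 \<otimes> {a\<^sub>2, b\<^sub>2}\<close> (\<open>sw_com\<close>), that it is normal from
  \<open>h\<^sub>1{a, b}S(h\<^sub>2) = {h\<^sub>1a, b\<^sub>1} {S\<^sup>2(b\<^sub>2), S\<^sup>2(h\<^sub>2)} g\<close> (\<open>adjoint_com\<close>), which rests on the formula
  for \<open>S\<^sup>4\<close>. Here \<open>g\<^sup>-\<^sup>1 = {1, 1}\<close> is in \<open>N\<close>, hence so is \<open>g\<close>, as multiplication by \<open>g\<^sup>-\<^sup>1\<close> is an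
  injective endomorphism of the finite-dimensional space \<open>N\<close>. For any normal left coideal
  subalgebra \<open>A\<close>, the left ideal \<open>HA\<^sup>+\<close> is a Hopf ideal (\<open>hopf_ideal_left_ideal_plus\<close>).

  The formula \<open>S\<^sup>4(a) = gag\<^sup>-\<^sup>1\<close> (\<open>S4\<close>) comes from the Frobenius form \<open>\<lambda>\<close>, a right integral of
  \<open>H\<^sup>*\<close>. It is nondegenerate (\<open>L_nondegenerate_S\<close>), which also makes \<open>S\<close> bijective and provides a
  nonzero integral \<open>\<Lambda>\<close> of \<open>H\<close>, two-sided by unimodularity. Evaluating \<open>\<lambda>(x\<Lambda>\<^sub>1)\<Lambda>\<^sub>2\<close> and
  \<open>\<lambda>(\<Lambda>\<^sub>1x)\<Lambda>\<^sub>2\<close> (\<open>Frobenius_formulas\<close>) yields \<open>\<lambda>(ab) = \<lambda>(S\<^sup>2(b)a)\<close> and \<open>\<lambda>(S(a)) = \<lambda>(ga)\<close>. Computing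
  \<open>\<lambda>(S(ab))\<close> with both rules, on \<open>ab\<close> and on \<open>S(b)S(a)\<close>, gives \<open>\<lambda>(gab) = \<lambda>(S\<^sup>4(a)gb)\<close> for all \<open>b\<close>,
  and nondegeneracy removes \<open>\<lambda>\<close>.
\<close>

section \<open>Multilinear maps and tensors\<close>

context vector_space
begin

definition lin :: "('b \<Rightarrow> 'b) \<Rightarrow> bool" where
  "lin f \<longleftrightarrow> (\<forall>x y. f (x + y) = f x + f y) \<and> (\<forall>c x. f (scale c x) = scale c (f x))"

definition bilin :: "('b \<Rightarrow> 'b \<Rightarrow> 'b) \<Rightarrow> bool" where
  "bilin f \<longleftrightarrow> (\<forall>y. lin (\<lambda>x. f x y)) \<and> (\<forall>x. lin (\<lambda>y. f x y))"

definition trilin :: "('b \<Rightarrow> 'b \<Rightarrow> 'b \<Rightarrow> 'b) \<Rightarrow> bool" where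
  "trilin f \<longleftrightarrow> (\<forall>y z. lin (\<lambda>x. f x y z)) \<and> (\<forall>x z. lin (\<lambda>y. f x y z)) \<and> (\<forall>x y. lin (\<lambda>z. f x y z))"

lemma linI: "(\<And>x y. f (x + y) = f x + f y) \<Longrightarrow> (\<And>c x. f (scale c x) = scale c (f x)) \<Longrightarrow> lin f"
  by (simp add: lin_def)

lemma lin_add: "lin f \<Longrightarrow> f (x + y) = f x + f y"
  and lin_scale: "lin f \<Longrightarrow> f (scale c x) = scale c (f x)"
  by (simp_all add: lin_def)

lemma lin_0: "lin f \<Longrightarrow> f 0 = 0"
  using lin_scale[of f 0 0] by simp

lemma lin_minus: "lin f \<Longrightarrow> f (- x) = - f x"
  using lin_scale[of f "-1" x] by simp

lemma lin_diff: "lin f \<Longrightarrow> f (x - y) = f x - f y"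
  using lin_add[of f x "- y"] lin_minus[of f y] by simp

lemma lin_sum_list: "lin f \<Longrightarrow> f (\<Sum>x\<leftarrow>xs. h x) = (\<Sum>x\<leftarrow>xs. f (h x))"
  by (induct xs) (simp_all add: lin_0 lin_add)

lemma lin_sum: "lin f \<Longrightarrow> f (\<Sum>x\<in>A. h x) = (\<Sum>x\<in>A. f (h x))"
  by (induct A rule: infinite_finite_induct) (simp_all add: lin_0 lin_add)

lemma lin_iff_linear: "lin f \<longleftrightarrow> Vector_Spaces.linear scale scale f"
  unfolding lin_def Vector_Spaces.linear_iff using vector_space_axioms by auto

lemma bilinI: "(\<And>y. lin (\<lambda>x. f x y)) \<Longrightarrow> (\<And>x. lin (\<lambda>y. f x y)) \<Longrightarrow> bilin f"
  by (simp add: bilin_def)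

lemma bilin_left: "bilin f \<Longrightarrow> lin (\<lambda>x. f x y)"
  and bilin_right: "bilin f \<Longrightarrow> lin (\<lambda>y. f x y)"
  by (simp_all add: bilin_def)

lemma trilinI: "(\<And>y z. lin (\<lambda>x. f x y z)) \<Longrightarrow> (\<And>x z. lin (\<lambda>y. f x y z)) \<Longrightarrow>
   (\<And>x y. lin (\<lambda>z. f x y z)) \<Longrightarrow> trilin f"
  by (simp add: trilin_def)

lemma lin_id: "lin (\<lambda>x. x)"
  by (rule linI) simp_all

lemma lin_comp: "lin f \<Longrightarrow> lin h \<Longrightarrow> lin (\<lambda>x. f (h x))"
  by (simp add: lin_def)

lemma lin_scale_right: "lin f \<Longrightarrow> lin (\<lambda>x. scale c (f x))"
  by (simp add: lin_def scale_right_distrib scale_left_commute)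

lemma lin_diff_fun: "lin f \<Longrightarrow> lin h \<Longrightarrow> lin (\<lambda>x. f x - h x)"
  by (simp add: lin_def scale_right_diff_distrib)

text \<open>
  The linear map on the free vector space that is determined by its values \<open>f\<close> on the generators.
\<close>

definition free_extension :: "('i \<Rightarrow> 'b) \<Rightarrow> ('i \<Rightarrow>\<^sub>0 'a) \<Rightarrow> 'b" where
  "free_extension f p = (\<Sum>i\<in>Poly_Mapping.keys p. scale (Poly_Mapping.lookup p i) (f i))"

lemma free_extension_superset:
  assumes "finite A" "Poly_Mapping.keys p \<subseteq> A"
  shows "free_extension f p = (\<Sum>i\<in>A. scale (Poly_Mapping.lookup p i) (f i))"
  unfolding free_extension_def using assms
  by (intro sum.mono_neutral_left) (auto simp: in_keys_iff)

lemma free_extension_add: "free_extension f (p + q) = free_extension f p + free_extension f q"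
proof -
  let ?A = "Poly_Mapping.keys p \<union> Poly_Mapping.keys q"
  have "Poly_Mapping.keys (p + q) \<subseteq> ?A" by (rule Poly_Mapping.keys_add)
  then show ?thesis
    by (simp add: free_extension_superset[of ?A] lookup_add scale_left_distrib sum.distrib)
qed

lemma free_extension_scale: "free_extension f (free_scale c p) = scale c (free_extension f p)"
proof -
  have "Poly_Mapping.keys (free_scale c p) \<subseteq> Poly_Mapping.keys p"
    by (auto simp: in_keys_iff)
  then show ?thesis
    by (simp add: free_extension_superset[of "Poly_Mapping.keys p"] scale_sum_right)
qed

lemma free_extension_linear: "Vector_Spaces.linear free_scale scale (free_extension f)"
  unfolding Vector_Spaces.linear_iff
  using vector_space_free_scale vector_space_axioms free_extension_add free_extension_scale by blast

lemma free_extension_pure: "free_extension f (pure i) = f i"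
  by (simp add: free_extension_def)

lemma free_extension_diff: "free_extension f (p - q) = free_extension f p - free_extension f q"
  using free_extension_add[of f "p - q" q] by (simp add: algebra_simps)

lemma free_extension_formal_sum: "free_extension f (formal_sum ts) = (\<Sum>t\<leftarrow>ts. f t)"
proof (induct ts)
  case Nil
  then show ?case by (simp add: formal_sum_def free_extension_def)
next
  case (Cons t ts)
  then show ?case by (simp add: formal_sum_def free_extension_add free_extension_pure)
qed

lemma free_extension_zero_on_span:
  assumes "p \<in> module.span free_scale R" "\<And>r. r \<in> R \<Longrightarrow> free_extension f r = 0"
  shows "free_extension f p = 0"
proof -
  interpret free: vector_space "free_scale :: 'a \<Rightarrow> ('c \<Rightarrow>\<^sub>0 'a) \<Rightarrow> _" by (rule vector_space_free_scale)
  interpret vector_space_pair "free_scale :: 'a \<Rightarrow> ('c \<Rightarrow>\<^sub>0 'a) \<Rightarrow> _" scale by unfold_locales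
  show ?thesis using linear_eq_0_on_span[OF free_extension_linear[of f] assms(2) assms(1)] by blast
qed

lemma tensor_eq_bilin:
  assumes "tensor_eq ts us" "bilin \<beta>"
  shows "(\<Sum>(x, y)\<leftarrow>ts. \<beta> x y) = (\<Sum>(x, y)\<leftarrow>us. \<beta> x y)"
proof -
  let ?f = "\<lambda>(x, y). \<beta> x y"
  have "free_extension ?f (formal_sum ts - formal_sum us) = 0"
    by (rule free_extension_zero_on_span[of _ tensor_relations])
       (use assms in \<open>auto simp: tensor_eq_def tensor_relations_def free_extension_diff
         free_extension_scale free_extension_pure bilin_def lin_def\<close>)
  then show ?thesis by (simp add: free_extension_diff free_extension_formal_sum)
qed

lemma tensor3_eq_trilin:
  assumes "tensor3_eq ts us" "trilin \<beta>"
  shows "(\<Sum>(x, y, z)\<leftarrow>ts. \<beta> x y z) = (\<Sum>(x, y, z)\<leftarrow>us. \<beta> x y z)"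
proof -
  let ?f = "\<lambda>(x, y, z). \<beta> x y z"
  have "free_extension ?f (formal_sum ts - formal_sum us) = 0"
    by (rule free_extension_zero_on_span[of _ tensor3_relations])
       (use assms in \<open>auto simp: tensor3_eq_def tensor3_relations_def free_extension_diff
         free_extension_scale free_extension_pure trilin_def lin_def\<close>)
  then show ?thesis by (simp add: free_extension_diff free_extension_formal_sum)
qed

text \<open>
  Bilinear maps with values in any nonzero space separate tensors: a vector outside the span of
  the relations is sent to \<open>v\<close> by some linear map that kills the relations, and such a map is
  bilinear on pairs.
\<close>

lemma tensor_eqI:
  assumes nz: "(v :: 'b) \<noteq> 0"
    and eq: "\<And>\<beta>. bilin \<beta> \<Longrightarrow> (\<Sum>(x, y)\<leftarrow>ts. \<beta> x y) = (\<Sum>(x, y)\<leftarrow>us. \<beta> x y)"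
  shows "tensor_eq ts us"
proof (rule ccontr)
  interpret free: vector_space "free_scale :: 'a \<Rightarrow> ('b \<times> 'b \<Rightarrow>\<^sub>0 'a) \<Rightarrow> _"
    by (rule vector_space_free_scale)
  interpret vector_space_pair "free_scale :: 'a \<Rightarrow> ('b \<times> 'b \<Rightarrow>\<^sub>0 'a) \<Rightarrow> _" scale by unfold_locales
  let ?d = "formal_sum ts - formal_sum us :: 'b \<times> 'b \<Rightarrow>\<^sub>0 'a"
  assume "\<not> tensor_eq ts us"
  then have notin: "?d \<notin> free.span tensor_relations" by (simp add: tensor_eq_def)
  obtain B where B: "B \<subseteq> tensor_relations" "free.independent B" "tensor_relations \<subseteq> free.span B"
    using free.maximal_independent_subset by blast
  have span: "free.span B = free.span tensor_relations"
    using B by (metis free.span_mono free.span_span subset_antisym)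
  then have "free.independent (insert ?d B)"
    using notin B(2) by (simp add: free.independent_insertI)
  from linear_independent_extend[OF this, of "\<lambda>x. if x = ?d then v else 0"]
  obtain F where F: "Vector_Spaces.linear free_scale scale F"
    and Fd: "F ?d = v" and FB: "\<And>b. b \<in> B \<Longrightarrow> b \<noteq> ?d \<Longrightarrow> F b = 0" by auto
  have "?d \<notin> B" using notin span free.span_base by metis
  then have F0: "F r = 0" if "r \<in> tensor_relations" for r
    using linear_eq_0_on_span[OF F, of B r] FB B(3) that by blast
  have Fdiff: "F (p - q) = F p - F q" for p q using F by (rule linear_diff)
  have Fadd: "F (p + q) = F p + F q" for p q using F by (rule linear_add)
  have Fscale: "F (free_scale c p) = scale c (F p)" for c p using F by (rule linear_scale)
  let ?\<beta> = "\<lambda>x y. F (pure (x, y))"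
  have "bilin ?\<beta>"
  proof (intro bilinI linI)
    show "F (pure (x + x', y)) = F (pure (x, y)) + F (pure (x', y))" for x x' y
    proof -
      have "pure (x + x', y) - pure (x, y) - pure (x', y) \<in> tensor_relations"
        unfolding tensor_relations_def by blast
      from F0[OF this] show ?thesis by (simp add: Fdiff Fadd algebra_simps)
    qed
    show "F (pure (x, y + y')) = F (pure (x, y)) + F (pure (x, y'))" for x y y'
    proof -
      have "pure (x, y + y') - pure (x, y) - pure (x, y') \<in> tensor_relations"
        unfolding tensor_relations_def by blast
      from F0[OF this] show ?thesis by (simp add: Fdiff Fadd algebra_simps)
    qed
    show "F (pure (scale c x, y)) = scale c (F (pure (x, y)))" for c x y
    proof -
      have "pure (scale c x, y) - free_scale c (pure (x, y)) \<in> tensor_relations"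
        unfolding tensor_relations_def by blast
      from F0[OF this] show ?thesis by (simp add: Fdiff Fscale)
    qed
    show "F (pure (x, scale c y)) = scale c (F (pure (x, y)))" for c x y
    proof -
      have "pure (x, scale c y) - free_scale c (pure (x, y)) \<in> tensor_relations"
        unfolding tensor_relations_def by blast
      from F0[OF this] show ?thesis by (simp add: Fdiff Fscale)
    qed
  qed
  moreover have "F (formal_sum ws) = (\<Sum>(x, y)\<leftarrow>ws. ?\<beta> x y)" for ws
    by (induct ws) (auto simp: formal_sum_def Fadd linear_0[OF F])
  ultimately have "F ?d = 0" using eq by (simp add: Fdiff)
  then show False using Fd nz by simp
qed

lemma finite_basis_exists:
  assumes "finite B" "span B = UNIV"
  shows "\<exists>C. finite C \<and> independent C \<and> span C = UNIV"
proof -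
  obtain C where "C \<subseteq> B" "independent C" "B \<subseteq> span C"
    using maximal_independent_subset by blast
  moreover from this have "span C = UNIV"
    using assms(2) by (metis span_mono span_span subset_antisym top_greatest)
  ultimately show ?thesis using assms(1) finite_subset by blast
qed

text \<open>
  Expanding the first legs of the tensor in the basis \<open>C\<close> writes it as a sum of \<open>c \<otimes> y\<^sub>c\<close>, where
  the second leg \<open>y\<^sub>c\<close> is a left contraction of the tensor and hence in \<open>J\<close>.
\<close>

lemma bilin_vanish_on_tensor:
  assumes C: "finite C" "independent C" "span C = UNIV" and \<beta>: "bilin \<beta>"
    and \<beta>0: "\<And>x y. y \<in> J \<Longrightarrow> \<beta> x y = 0"
    and J: "\<And>f. Vector_Spaces.linear scale (*) f \<Longrightarrow> (\<Sum>(x, y)\<leftarrow>ts. scale (f x) y) \<in> J"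
  shows "(\<Sum>(x, y)\<leftarrow>ts. \<beta> x y) = 0"
proof -
  let ?r = "\<lambda>c x. representation C x c"
  have x: "(\<Sum>c\<in>C. scale (?r c x) c) = x" for x
    using sum_representation_eq[OF C(2), of x C] C by auto
  have expand: "\<beta> x y = (\<Sum>c\<in>C. \<beta> c (scale (?r c x) y))" for x y
  proof -
    have "\<beta> x y = \<beta> (\<Sum>c\<in>C. scale (?r c x) c) y" by (simp add: x)
    also have "\<dots> = (\<Sum>c\<in>C. \<beta> c (scale (?r c x) y))"
      by (simp add: lin_sum[OF bilin_left[OF \<beta>]] lin_scale[OF bilin_left[OF \<beta>]]
          lin_scale[OF bilin_right[OF \<beta>]])
    finally show ?thesis .
  qed
  have "(\<Sum>(x, y)\<leftarrow>ts. \<beta> x y) = (\<Sum>(x, y)\<leftarrow>ts. \<Sum>c\<in>C. \<beta> c (scale (?r c x) y))"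
    by (subst expand) (rule refl)
  also have "\<dots> = (\<Sum>c\<in>C. \<Sum>(x, y)\<leftarrow>ts. \<beta> c (scale (?r c x) y))"
    by (induct ts) (auto simp: sum.distrib)
  also have "\<dots> = (\<Sum>c\<in>C. \<beta> c (\<Sum>(x, y)\<leftarrow>ts. scale (?r c x) y))"
    by (simp add: lin_sum_list[OF bilin_right[OF \<beta>]] case_prod_unfold)
  also have "\<dots> = 0"
    by (intro sum.neutral ballI \<beta>0 J linear_representation C)
  finally show ?thesis .
qed

end

section \<open>Sweedler calculus\<close>

context hopf_algebra
begin

abbreviation "S \<equiv> antipode"

text \<open>
  The Sweedler expression \<open>f(a\<^sub>1, a\<^sub>2)\<close> for \<open>H\<close>-valued \<open>f\<close>. With the element before the function,
  iterated coproducts read from left to right: \<open>sw a (\<lambda>a1 t. sw t (\<lambda>a2 a3. \<dots>))\<close>. Scalar-valued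
  expressions are treated as multiples of \<open>1\<close>, so that one notion of linearity suffices.
\<close>

definition sw :: "'h \<Rightarrow> ('h \<Rightarrow> 'h \<Rightarrow> 'h) \<Rightarrow> 'h" where
  "sw a f = (\<Sum>(x, y)\<leftarrow>comult a. f x y)"

lemma lin_mult_left: "lin f \<Longrightarrow> lin (\<lambda>x. f x * c)"
  by (simp add: lin_def distrib_right scale_mult_left)

lemma lin_mult_right: "lin f \<Longrightarrow> lin (\<lambda>x. c * f x)"
  by (simp add: lin_def distrib_left scale_mult_right)

lemma lin_counit: "lin f \<Longrightarrow> lin (\<lambda>x. scale (counit (f x)) c)"
  using counit_linear unfolding Vector_Spaces.linear_iff
  by (simp add: lin_def scale_left_distrib)

lemma lin_S: "lin f \<Longrightarrow> lin (\<lambda>x. S (f x))"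
  by (rule lin_comp) (simp_all add: lin_iff_linear antipode_linear)

lemmas S_0 = lin_0[OF lin_S[OF lin_id]] and S_add = lin_add[OF lin_S[OF lin_id]]
  and S_diff = lin_diff[OF lin_S[OF lin_id]] and S_scale = lin_scale[OF lin_S[OF lin_id]]

lemma sum_list_swap: "(\<Sum>x\<leftarrow>xs. \<Sum>y\<leftarrow>ys. f x y) = (\<Sum>y\<leftarrow>ys. \<Sum>x\<leftarrow>xs. (f x y :: 'h))"
  by (induct xs) (simp_all add: sum_list_addf)

lemma sw_swap: "sw a (\<lambda>x y. sw b (\<lambda>u v. f x y u v)) = sw b (\<lambda>u v. sw a (\<lambda>x y. f x y u v))"
  unfolding sw_def case_prod_unfold by (rule sum_list_swap)

lemma sw_lin: "lin f \<Longrightarrow> f (sw a F) = sw a (\<lambda>x y. f (F x y))"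
  by (simp add: sw_def lin_sum_list case_prod_unfold)

lemma sw_add_arg: "bilin F \<Longrightarrow> sw (a + b) F = sw a F + sw b F"
  using tensor_eq_bilin[OF comult_add, of F a b] by (simp add: sw_def)

lemma sw_scale_arg:
  assumes "bilin F" shows "sw (scale c a) F = scale c (sw a F)"
proof -
  have "sw (scale c a) F = (\<Sum>(x, y)\<leftarrow>comult a. F (scale c x) y)"
    using tensor_eq_bilin[OF comult_scale assms, of c a] by (simp add: sw_def case_prod_unfold comp_def)
  also have "\<dots> = sw a (\<lambda>x y. scale c (F x y))"
    by (simp add: sw_def lin_scale[OF bilin_left[OF assms]])
  finally show ?thesis by (simp add: sw_lin[OF lin_scale_right[OF lin_id], symmetric])
qed

lemma lin_sw_arg: "bilin F \<Longrightarrow> lin f \<Longrightarrow> lin (\<lambda>x. sw (f x) F)"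
  by (rule linI) (simp_all add: lin_add lin_scale sw_add_arg sw_scale_arg)

lemma lin_sw_body:
  assumes "\<And>u v. lin (\<lambda>x. F x u v)" shows "lin (\<lambda>x. sw a (F x))"
proof (rule linI)
  show "sw a (F (x + y)) = sw a (F x) + sw a (F y)" for x y
    by (simp add: sw_def case_prod_unfold lin_add[OF assms] sum_list_addf)
  show "sw a (F (scale c x)) = scale c (sw a (F x))" for c x
    by (simp add: sw_lin[OF lin_scale_right[OF lin_id]]) (simp add: sw_def lin_scale[OF assms])
qed

text \<open>
  In a Sweedler expression each leg occurs once, so linearity in a leg can be read off from the
  syntax by these rules. They discharge the side conditions of all rewriting below.
\<close>

lemmas multilin = bilinI trilinI lin_id lin_mult_left lin_mult_right lin_counit lin_S lin_scale_right
  lin_sw_body lin_sw_arg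

lemma sum_list_concat_map: "(\<Sum>t\<leftarrow>concat (map f xs). h t) = (\<Sum>x\<leftarrow>xs. \<Sum>t\<leftarrow>f x. (h t :: 'h))"
  by (induct xs) simp_all

lemma sw_assoc: "trilin f \<Longrightarrow>
    sw a (\<lambda>x y. sw x (\<lambda>u v. f u v y)) = sw a (\<lambda>x y. sw y (\<lambda>u v. f x u v))"
  using tensor3_eq_trilin[OF coassoc, of f a]
  by (simp add: sw_def sum_list_concat_map case_prod_unfold comp_def)

lemma sw_mult: "bilin f \<Longrightarrow> sw (a * b) f = sw a (\<lambda>x y. sw b (\<lambda>u v. f (x * u) (y * v)))"
  using tensor_eq_bilin[OF comult_mult, of f a b]
  by (simp add: sw_def sum_list_concat_map case_prod_unfold comp_def)

lemma sw_1: "bilin f \<Longrightarrow> sw 1 f = f 1 1"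
  using tensor_eq_bilin[OF comult_one, of f] by (simp add: sw_def)

lemma sw_counit_left: "lin f \<Longrightarrow> sw a (\<lambda>x y. scale (counit x) (f y)) = f a"
  using arg_cong[OF counit_left[of a], of f]
  by (simp add: sw_def lin_sum_list case_prod_unfold lin_scale)

lemma sw_counit_right: "lin f \<Longrightarrow> sw a (\<lambda>x y. scale (counit y) (f x)) = f a"
  using arg_cong[OF counit_right[of a], of f]
  by (simp add: sw_def lin_sum_list case_prod_unfold lin_scale)

lemma sw_S_left: "lin f \<Longrightarrow> sw a (\<lambda>x y. f (S x * y)) = scale (counit a) (f 1)"
  using arg_cong[OF antipode_left[of a], of f]
  by (simp add: sw_def lin_sum_list case_prod_unfold lin_scale)

lemma sw_S_right: "lin f \<Longrightarrow> sw a (\<lambda>x y. f (x * S y)) = scale (counit a) (f 1)"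
  using arg_cong[OF antipode_right[of a], of f]
  by (simp add: sw_def lin_sum_list case_prod_unfold lin_scale)

text \<open>
  Regrouping \<open>(a\<^sub>1 \<otimes> a\<^sub>2) \<otimes> (a\<^sub>3 \<otimes> a\<^sub>4)\<close> as \<open>a\<^sub>1 \<otimes> ((a\<^sub>2 \<otimes> a\<^sub>3) \<otimes> a\<^sub>4)\<close> lets the two middle legs cancel against
  each other.
\<close>

lemma sw_middle:
  assumes "\<And>q u v. lin (\<lambda>p. f p q u v)" "\<And>p u v. lin (\<lambda>q. f p q u v)"
    "\<And>p q v. lin (\<lambda>u. f p q u v)" "\<And>p q u. lin (\<lambda>v. f p q u v)"
  shows "sw a (\<lambda>x y. sw x (\<lambda>p q. sw y (\<lambda>u v. f p q u v)))
    = sw a (\<lambda>p r. sw r (\<lambda>m v. sw m (\<lambda>q u. f p q u v)))"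
proof -
  have "sw a (\<lambda>x y. sw x (\<lambda>p q. sw y (\<lambda>u v. f p q u v)))
    = sw a (\<lambda>p r. sw r (\<lambda>q y. sw y (\<lambda>u v. f p q u v)))"
    by (rule sw_assoc) (intro multilin assms)
  also have "\<dots> = sw a (\<lambda>p r. sw r (\<lambda>m v. sw m (\<lambda>q u. f p q u v)))"
    by (subst sw_assoc) (intro multilin assms, rule refl)
  finally show ?thesis .
qed

lemma sw_cong: "(\<And>x y. f x y = h x y) \<Longrightarrow> sw a f = sw a h"
  by (simp add: sw_def)

lemma sw_0: "sw a (\<lambda>x y. 0) = 0"
  by (simp add: sw_def case_prod_unfold)

lemma sw_pull_scale: "sw a (\<lambda>x y. scale c (F x y)) = scale c (sw a F)"
  by (simp add: sw_lin[OF lin_scale_right[OF lin_id]])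

lemma sw_pull_left: "sw a (\<lambda>x y. c * F x y) = c * sw a F"
  by (simp add: sw_lin[OF lin_mult_right[OF lin_id]])

lemma sw_pull_right: "sw a (\<lambda>x y. F x y * c) = sw a F * c"
  by (simp add: sw_lin[OF lin_mult_left[OF lin_id]])

lemma sw_times: "sw a f * sw b h = sw a (\<lambda>p q. sw b (\<lambda>u v. f p q * h u v))"
  by (simp only: sw_pull_left sw_pull_right)

lemma sw_times2:
  "sw a (\<lambda>p q. sw b (\<lambda>r s. f p q r s)) * sw c (\<lambda>u v. sw d (\<lambda>m n. h u v m n))
    = sw a (\<lambda>p q. sw b (\<lambda>r s. sw c (\<lambda>u v. sw d (\<lambda>m n. f p q r s * h u v m n))))"
  by (simp only: sw_pull_left sw_pull_right)

lemma sw_S_left': "sw a (\<lambda>x y. S x * y) = scale (counit a) 1"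
    "sw a (\<lambda>x y. S x * (y * c)) = scale (counit a) c"
  using sw_S_left[OF lin_id, of a] sw_S_left[OF lin_mult_left[OF lin_id, of c], of a]
  by (simp_all add: mult.assoc)

lemma sw_S_right': "sw a (\<lambda>x y. x * S y) = scale (counit a) 1"
    "sw a (\<lambda>x y. x * (S y * c)) = scale (counit a) c"
  using sw_S_right[OF lin_id, of a] sw_S_right[OF lin_mult_left[OF lin_id, of c], of a]
  by (simp_all add: mult.assoc)

text \<open>
  With products associated to the right, these rules pull constants out of a Sweedler sum until
  an antipode or counit cancellation applies.
\<close>

lemmas cancel = mult.assoc sw_pull_scale sw_pull_left sw_S_left' sw_S_right'
  sw_counit_left sw_counit_right scale_mult_left[symmetric] scale_mult_right[symmetric]
  counit_mult counit_one

text \<open>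
  Both sides are values of \<open>S(a\<^sub>1b\<^sub>1) a\<^sub>2b\<^sub>2 S(b\<^sub>3)S(a\<^sub>3)\<close>: cancelling the last four factors leaves the
  left-hand side, cancelling the first two products leaves the right-hand side.
\<close>

lemma S_mult: "S (a * b) = S b * S a"
proof -
  let ?F = "\<lambda>a1 a2 a3 b1 b2 b3. S (a1 * b1) * (a2 * b2) * (S b3 * S a3)"
  have left: "sw a' (\<lambda>a1 a2. sw b' (\<lambda>b1 b2. ?F a1 a2 a3 b1 b2 b3))
      = scale (counit a') (scale (counit b') (S b3 * S a3))" for a' b' a3 b3
    using sw_S_left[of "\<lambda>t. t * (S b3 * S a3)" "a' * b'"]
    by (simp add: multilin counit_mult sw_mult)
  have "S (a * b) = sw a (\<lambda>a1 a'. sw a' (\<lambda>a2 a3. sw b (\<lambda>b1 b'. sw b' (\<lambda>b2 b3.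
      ?F a1 a2 a3 b1 b2 b3))))"
    by (simp add: cancel multilin)
  also have "\<dots> = sw a (\<lambda>a' a3. sw a' (\<lambda>a1 a2. sw b (\<lambda>b' b3. sw b' (\<lambda>b1 b2.
      ?F a1 a2 a3 b1 b2 b3))))"
    by (simp add: sw_assoc multilin)
  also have "\<dots> = sw a (\<lambda>a' a3. sw b (\<lambda>b' b3. sw a' (\<lambda>a1 a2. sw b' (\<lambda>b1 b2.
      ?F a1 a2 a3 b1 b2 b3))))"
    by (rule sw_cong, rule sw_swap)
  also have "\<dots> = S b * S a"
    by (simp add: left multilin sw_counit_left sw_pull_scale del: scale_scale)
  finally show ?thesis .
qed

lemma S_1: "S 1 = 1"
  using sw_S_left'(1)[of 1] by (simp add: sw_1 multilin counit_one)

lemma counit_S: "counit (S a) = counit a"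
proof -
  have lin: "lin (\<lambda>x. scale (counit x) 1)" by (simp add: multilin)
  have "scale (counit (sw a (\<lambda>x y. S x * y))) 1 = scale (counit (S a)) (1 :: 'h)"
    using sw_counit_right[of "\<lambda>x. scale (counit (S x)) 1" a]
    by (simp add: sw_lin[OF lin] multilin counit_mult mult.commute)
  moreover have "counit (scale c 1) = c" for c
    using counit_linear by (simp add: Vector_Spaces.linear_iff counit_one)
  moreover have "(1 :: 'h) \<noteq> 0" by simp
  ultimately show ?thesis by (simp add: sw_S_left')
qed

text \<open>
  Both sides are values of \<open>\<Delta>(S(a\<^sub>1)) (a\<^sub>2 \<otimes> a\<^sub>3) (S(a\<^sub>5) \<otimes> S(a\<^sub>4))\<close>: cancelling the last two factors
  leaves \<open>\<Delta>(S(a))\<close>, while the first two are \<open>\<Delta>(S(a\<^sub>1)a\<^sub>2)\<close>, and cancelling them leaves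
  \<open>S(a\<^sub>2) \<otimes> S(a\<^sub>1)\<close>.
\<close>

lemma sw_S:
  assumes f: "bilin f"
  shows "sw (S a) f = sw a (\<lambda>x y. f (S y) (S x))"
proof -
  note f' = lin_comp[OF bilin_left[OF f]] lin_comp[OF bilin_right[OF f]]
  \<comment> \<open>the value of \<open>f\<close> on the tensor \<open>\<Delta>(w) (s \<otimes> t)\<close>\<close>
  let ?M = "\<lambda>w s t. sw w (\<lambda>p q. f (p * s) (q * t))"
  have M: "bilin (\<lambda>p q. f (p * s) (q * t))" for s t by (simp add: multilin f')
  have 1: "sw b (\<lambda>u v. ?M w (u * s) (v * t)) = ?M (w * b) s t" for w b s t
    using M[of s t] by (subst sw_mult) (simp_all add: mult.assoc sw_swap[of b w])
  have 2: "sw b (\<lambda>x y. ?M w s (x * S y)) = scale (counit b) (?M w s 1)" for w s b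
    using sw_S_right[of "\<lambda>t. ?M w s t" b] by (simp add: multilin f')
  have 3: "sw b (\<lambda>x y. ?M w (x * S y) t) = scale (counit b) (?M w 1 t)" for w b t
    using sw_S_right[of "\<lambda>s. ?M w s t" b] by (simp add: multilin f')
  have "sw a (\<lambda>a1 b. sw b (\<lambda>a2 c. sw c (\<lambda>d a5. sw d (\<lambda>a3 a4.
      ?M (S a1) (a2 * S a5) (a3 * S a4))))) = sw a (\<lambda>a1 b. scale (counit b) (?M (S a1) 1 1))"
    by (simp only: 2 3 sw_counit_left multilin f')
  also have "\<dots> = sw (S a) f"
    by (simp add: sw_counit_right multilin f' f)
  finally have "sw (S a) f = sw a (\<lambda>a1 b. sw b (\<lambda>a2 c. sw c (\<lambda>d a5. sw d (\<lambda>a3 a4.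
      ?M (S a1) (a2 * S a5) (a3 * S a4)))))" ..
  also have "\<dots> = sw a (\<lambda>x a5. sw x (\<lambda>y a4. sw y (\<lambda>a1 b. sw b (\<lambda>a2 a3.
      ?M (S a1) (a2 * S a5) (a3 * S a4)))))"
    by (simp add: sw_assoc multilin f' M)
  also have "\<dots> = sw a (\<lambda>x a5. sw x (\<lambda>y a4. sw y (\<lambda>a1 b. ?M (S a1 * b) (S a5) (S a4))))"
    by (simp only: 1)
  also have "\<dots> = sw a (\<lambda>x a5. sw x (\<lambda>y a4. scale (counit y) (f (S a5) (S a4))))"
    using sw_S_left[of "\<lambda>t. ?M t _ _"] by (simp add: multilin M sw_1)
  also have "\<dots> = sw a (\<lambda>x y. f (S y) (S x))"
    by (simp add: sw_counit_left multilin f')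
  finally show ?thesis .
qed

lemma finite_dimensional_basis:
  "finite_dimensional \<Longrightarrow> \<exists>C. finite C \<and> independent C \<and> span C = UNIV"
  using finite_basis_exists by (auto simp: finite_dimensional_def)

lemma finite_dimensional_inj_imp_surj:
  assumes fd: finite_dimensional and f: "lin f" and inj: "\<And>x. f x = 0 \<Longrightarrow> x = 0"
  shows "surj f"
proof -
  obtain C where C: "finite C" "independent C" "span C = UNIV"
    using finite_dimensional_basis[OF fd] by blast
  interpret finite_dimensional_vector_space scale C
    by unfold_locales (use C in auto)
  have "inj f"
  proof (rule injI)
    fix x y assume "f x = f y"
    then have "f (x - y) = 0" by (simp add: lin_diff[OF f])
    then show "x = y" using inj[of "x - y"] by simp
  qed
  then show ?thesis
    using f by (simp add: lin_iff_linear linear_inj_imp_surj)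
qed

lemma counit_add: "counit (x + y) = counit x + counit y"
  and counit_scale: "counit (scale c x) = c * counit x"
  using counit_linear by (simp_all add: Vector_Spaces.linear_iff)

lemma counit_diff: "counit (x - y) = counit x - counit y"
  using counit_add[of "x - y" y] by (simp add: algebra_simps)

lemma counit_sw: "counit (sw a f) = (\<Sum>(x, y)\<leftarrow>comult a. counit (f x y))"
proof -
  have "counit (\<Sum>p\<leftarrow>xs. h p) = (\<Sum>p\<leftarrow>xs. counit (h p))" for xs :: "('h \<times> 'h) list" and h
    using counit_scale[of 0 0] by (induct xs) (simp_all add: counit_add)
  then show ?thesis by (simp add: sw_def case_prod_unfold)
qed

lemma sw_in_subspace:
  assumes "subspace A" "\<And>x y. f x y \<in> A" shows "sw a f \<in> A"
proof -
  have "(\<Sum>(x, y)\<leftarrow>xs. f x y) \<in> A" for xs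
    by (induct xs) (auto simp: subspace_0 subspace_add assms)
  then show ?thesis by (simp add: sw_def)
qed

lemma sw_diff: "sw a (\<lambda>x y. f x y - h x y) = sw a f - sw a h"
  by (simp add: sw_def case_prod_unfold sum_list_subtractf)

lemma span_lin_image:
  assumes "x \<in> span X" "lin f" "subspace V" "\<And>x. x \<in> X \<Longrightarrow> f x \<in> V"
  shows "f x \<in> V"
proof -
  have "subspace {x. f x \<in> V}"
    unfolding subspace_def using assms(2,3)
    by (simp add: lin_0 lin_add lin_scale subspace_0 subspace_add subspace_scale)
  then show ?thesis using span_minimal[of X "{x. f x \<in> V}"] assms(1,4) by auto
qed

definition adjoint :: "'h \<Rightarrow> 'h \<Rightarrow> 'h" where
  "adjoint h x = sw h (\<lambda>h1 h2. h1 * (x * S h2))"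

lemma lin_adjoint: "lin f \<Longrightarrow> lin (\<lambda>x. adjoint h (f x))"
  unfolding adjoint_def by (intro multilin)

lemma adjoint_mult: "adjoint h (x * y) = sw h (\<lambda>h1 h2. adjoint h1 x * adjoint h2 y)"
proof -
  have "sw h (\<lambda>h1 h2. adjoint h1 x * adjoint h2 y)
    = sw h (\<lambda>h1 h2. sw h1 (\<lambda>p q. sw h2 (\<lambda>u v. p * (x * (S q * (u * (y * S v)))))))"
    by (simp only: adjoint_def sw_times mult.assoc)
  also have "\<dots> = sw h (\<lambda>p r. sw r (\<lambda>m v. sw m (\<lambda>q u. p * (x * (S q * (u * (y * S v)))))))"
    by (rule sw_middle) (intro multilin)+
  also have "\<dots> = adjoint h (x * y)"
    by (simp add: adjoint_def cancel multilin)
  finally show ?thesis ..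
qed

lemma adjoint_1: "adjoint h 1 = scale (counit h) 1"
  by (simp add: adjoint_def cancel multilin)

lemma counit_adjoint: "counit (adjoint h x) = counit h * counit x"
proof -
  have "counit (adjoint h x) = counit x * (\<Sum>(h1, h2)\<leftarrow>comult h. counit h1 * counit h2)"
    by (simp add: adjoint_def counit_sw counit_mult counit_S case_prod_unfold sum_list_const_mult
        mult.left_commute)
  also have "(\<Sum>(h1, h2)\<leftarrow>comult h. counit h1 * counit h2) = counit (sw h (\<lambda>x y. scale (counit x) y))"
    by (simp add: counit_sw counit_scale)
  finally show ?thesis by (simp add: sw_counit_left multilin mult.commute)
qed

end

section \<open>Nondegeneracy of the integral of the dual\<close>

locale unimodular_hopf_algebra = hopf_algebra scale comult counit antipode
  for scale :: "'k::field \<Rightarrow> 'h::ring_1 \<Rightarrow> 'h" and comult counit antipode +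
  fixes l :: "'h \<Rightarrow> 'k" and g :: 'h
  assumes fd: finite_dimensional and unimod: unimodular
    and integral: "dual_right_integral l" and nonzero: "\<exists>a. l a \<noteq> 0"
    and distinguished: "(\<Sum>(x, y)\<leftarrow>comult a. scale (l y) x) = scale (l a) g"
begin

text \<open>
  The integral \<open>\<lambda>\<close> (the functional \<open>l\<close>) as an endomorphism of \<open>H\<close> with central values, so that it
  can be used inside Sweedler expressions.
\<close>

definition L :: "'h \<Rightarrow> 'h" where "L x = scale (l x) 1"

lemma l_linear: "Vector_Spaces.linear scale (*) l"
  using integral by (simp add: dual_right_integral_def)

lemma l_add: "l (x + y) = l x + l y" and l_scale: "l (scale c x) = c * l x"
  using l_linear by (simp_all add: Vector_Spaces.linear_iff)

lemma linear_l_comp: "lin f \<Longrightarrow> Vector_Spaces.linear scale (*) (\<lambda>x. l (f x))"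
  using l_linear by (simp add: Vector_Spaces.linear_iff lin_def)

lemma lin_l: "lin f \<Longrightarrow> lin (\<lambda>x. scale (l (f x)) c)"
  by (simp add: lin_def l_add l_scale scale_left_distrib)

lemma L_scale: "L (scale c x) = scale c (L x)"
  by (simp add: L_def l_scale)

lemma lin_L: "lin f \<Longrightarrow> lin (\<lambda>x. L (f x))"
  by (rule lin_comp) (simp_all add: lin_def L_def l_add l_scale scale_left_distrib)

lemmas L_0 = lin_0[OF lin_L[OF lin_id]] and L_diff = lin_diff[OF lin_L[OF lin_id]]

lemmas multilinL = multilin lin_L lin_l

lemma L_mult: "L x * y = scale (l x) y" and mult_L: "y * L x = scale (l x) y"
  using scale_mult_left[of "l x" 1 y] scale_mult_right[of "l x" y 1] by (simp_all add: L_def)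

lemma L_left_commute: "h * (L x * y) = L x * (h * y)"
  by (simp add: L_mult scale_mult_right)

lemma L_mult_L: "L (L x * y) = L x * L y" "L (y * L x) = L x * L y"
  unfolding L_mult mult_L by (simp_all add: L_def l_scale)

lemma L_integral: "sw a (\<lambda>x y. L x * y) = L a"
  unfolding L_mult using integral by (simp add: dual_right_integral_def sw_def L_def)

lemma L_distinguished: "sw a (\<lambda>x y. x * L y) = L a * g"
  using distinguished[of a] by (simp add: sw_def L_mult mult_L)

text \<open>
  Both sides equal \<open>\<lambda>(a\<^sub>1b\<^sub>1)a\<^sub>2b\<^sub>2S(b\<^sub>3)\<close>; the right-hand side uses the integral property for \<open>ab\<^sub>1\<close>.
\<close>

lemma L_shift_right: "sw a (\<lambda>x y. L (x * b) * y) = sw b (\<lambda>x y. L (a * x) * S y)"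
proof -
  have 1: "sw a (\<lambda>a1 a2. sw b (\<lambda>x y. L (a1 * x) * (a2 * y))) = L (a * b)" for b
    using L_integral[of "a * b"] by (simp add: sw_mult multilinL)
  have "sw a (\<lambda>x y. L (x * b) * y) = sw a (\<lambda>a1 a2. sw b (\<lambda>b1 c. sw c (\<lambda>b2 b3.
      L (a1 * b1) * (a2 * b2) * S b3)))"
    by (simp add: cancel multilinL)
  also have "\<dots> = sw a (\<lambda>a1 a2. sw b (\<lambda>c b3. sw c (\<lambda>b1 b2. L (a1 * b1) * (a2 * b2) * S b3)))"
    by (simp add: sw_assoc multilinL)
  also have "\<dots> = sw b (\<lambda>c b3. sw a (\<lambda>a1 a2. sw c (\<lambda>b1 b2. L (a1 * b1) * (a2 * b2) * S b3)))"
    by (rule sw_swap)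
  also have "\<dots> = sw b (\<lambda>x y. L (a * x) * S y)"
    by (simp only: sw_pull_right 1)
  finally show ?thesis .
qed

text \<open>
  Both sides equal \<open>h\<^sub>1\<lambda>(S(h\<^sub>3)b\<^sub>1)S(h\<^sub>2)b\<^sub>2\<close>; the right-hand side uses the integral property for \<open>S(h\<^sub>2)b\<close>.
\<close>

lemma L_shift_left: "sw b (\<lambda>x y. L (S h * x) * y) = sw h (\<lambda>x y. L (S y * b) * x)"
proof -
  have 1: "sw h (\<lambda>u v. sw b (\<lambda>x y. L (S v * x) * (S u * y))) = L (S h * b)" for h
    using L_integral[of "S h * b"] by (simp add: sw_mult sw_S multilinL)
  have "sw b (\<lambda>x y. L (S h * x) * y) = sw h (\<lambda>d h3. sw d (\<lambda>h1 h2. sw b (\<lambda>x y.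
      h1 * (L (S h3 * x) * (S h2 * y)))))"
  proof -
    have "sw d (\<lambda>h1 h2. sw b (\<lambda>x y. h1 * (L (S h3 * x) * (S h2 * y))))
      = scale (counit d) (sw b (\<lambda>x y. L (S h3 * x) * y))" for d h3
      by (subst sw_swap) (simp add: L_left_commute cancel multilinL)
    then show ?thesis by (simp add: sw_counit_left multilinL)
  qed
  also have "\<dots> = sw h (\<lambda>h1 d. sw d (\<lambda>h2 h3. sw b (\<lambda>x y. h1 * (L (S h3 * x) * (S h2 * y)))))"
    by (simp add: sw_assoc multilinL)
  also have "\<dots> = sw h (\<lambda>x y. L (S y * b) * x)"
    by (simp only: sw_pull_left 1) (simp add: L_mult mult_L)
  finally show ?thesis .
qed

text \<open>
  Injectivity of \<open>S\<close> is not known yet, so nondegeneracy is shown for left arguments of the form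
  \<open>S(h)\<close>. By \<open>L_shift_left\<close> the elements \<open>h\<close> with \<open>\<lambda>(S(h)H) = 0\<close> form a set \<open>J\<close> with
  \<open>\<Delta>(J) \<subseteq> H \<otimes> J\<close>. Hence for \<open>h \<in> J\<close> the expression \<open>\<lambda>(S(h\<^sub>3)S\<^sup>2(h\<^sub>2)a)h\<^sub>1\<close> vanishes; but it equals
  \<open>\<lambda>(a)h\<close>, since \<open>S(h\<^sub>2)S\<^sup>2(h\<^sub>1) = S(S(h\<^sub>1)h\<^sub>2)\<close>.
\<close>

lemma L_nondegenerate_S:
  assumes "\<And>x. L (S h * x) = 0" shows "h = 0"
proof -
  obtain C where C: "finite C" "independent C" "span C = UNIV"
    using finite_dimensional_basis[OF fd] by blast
  obtain a where a: "l a \<noteq> 0" using nonzero by blast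
  let ?J = "{h. \<forall>x. L (S h * x) = 0}"
  let ?\<beta> = "\<lambda>p q. sw p (\<lambda>u v. L (S q * (S (S v) * a)) * u)"
  have "sw h ?\<beta> = 0"
    unfolding sw_def[of h]
  proof (rule bilin_vanish_on_tensor[OF C, where J = ?J])
    show "bilin ?\<beta>" by (simp add: multilinL)
    show "?\<beta> x y = 0" if "y \<in> ?J" for x y using that by (simp add: sw_0)
    show "(\<Sum>(x, y)\<leftarrow>comult h. scale (f x) y) \<in> ?J" if f: "Vector_Spaces.linear scale (*) f" for f
    proof (intro CollectI allI)
      fix b
      let ?f = "\<lambda>x. scale (f x) 1"
      have lf: "lin ?f" using f by (simp add: lin_def Vector_Spaces.linear_iff scale_left_distrib)
      have "L (S (\<Sum>(x, y)\<leftarrow>comult h. scale (f x) y) * b)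
          = L (S (sw h (\<lambda>x y. scale (f x) y)) * b)" by (simp add: sw_def)
      also have "\<dots> = sw h (\<lambda>x y. L (S (scale (f x) y) * b))"
        by (rule sw_lin[of "\<lambda>t. L (S t * b)"]) (simp add: multilinL)
      also have "\<dots> = sw h (\<lambda>x y. scale (f x) (L (S y * b)))"
        by (simp add: lin_scale[of "\<lambda>t. L (S t * b)"] multilinL)
      also have "\<dots> = sw h (\<lambda>x y. ?f (L (S y * b) * x))"
        using f by (simp add: L_mult Vector_Spaces.linear_iff) (simp add: L_def mult.commute)
      also have "\<dots> = ?f (sw h (\<lambda>x y. L (S y * b) * x))"
        by (rule sw_lin[OF lf, symmetric])
      also have "\<dots> = ?f (sw b (\<lambda>x y. L (S h * x) * y))" by (simp add: L_shift_left)
      also have "\<dots> = 0" using lin_0[OF lf] assms by (simp add: sw_0)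
      finally show "L (S (\<Sum>(x, y)\<leftarrow>comult h. scale (f x) y) * b) = 0" .
    qed
  qed
  moreover have "sw h ?\<beta> = scale (l a) h"
  proof -
    have "sw h ?\<beta> = sw h (\<lambda>u q. sw q (\<lambda>v q. L (S (S v * q) * a) * u))"
      by (subst sw_assoc) (simp_all add: multilinL S_mult mult.assoc)
    also have "\<dots> = sw h (\<lambda>u q. scale (counit q) (L a * u))"
      using sw_S_left[of "\<lambda>t. L (S t * a) * _"] by (simp add: multilinL S_1)
    also have "\<dots> = scale (l a) h"
      by (simp add: sw_counit_right multilinL L_mult del: scale_scale)
    finally show ?thesis .
  qed
  ultimately show ?thesis using a by simp
qed

lemma S_injective: "S h = 0 \<Longrightarrow> h = 0"
  by (rule L_nondegenerate_S) (simp add: L_0)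

lemma surj_S: "surj S"
  using finite_dimensional_inj_imp_surj[OF fd lin_S[OF lin_id]] S_injective by blast

lemma inj_S: "inj S"
proof (rule injI)
  fix x y assume "S x = S y"
  then have "S (x - y) = 0" by (simp add: S_diff)
  then show "x = y" using S_injective[of "x - y"] by simp
qed

abbreviation "T \<equiv> inv_into UNIV S"

lemma S_T: "S (T x) = x" and T_S: "T (S x) = x"
  by (simp_all add: surj_f_inv_f surj_S inj_S)

lemma T_eqI: "S x = y \<Longrightarrow> T y = x"
  using T_S[of x] by simp

lemma lin_T:
  assumes "lin f" shows "lin (\<lambda>x. T (f x))"
proof (rule lin_comp[OF linI assms])
  show "T (x + y) = T x + T y" for x y
    by (rule T_eqI) (simp add: S_add S_T)
  show "T (scale c x) = scale c (T x)" for c x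
    by (rule T_eqI) (simp add: S_scale S_T)
qed

lemmas multilinT = multilinL lin_T

lemma T_mult: "T (a * b) = T b * T a"
  by (rule T_eqI) (simp add: S_mult S_T)

lemma T_1: "T 1 = 1"
  by (rule T_eqI) (rule S_1)

lemma counit_T: "counit (T a) = counit a"
  using counit_S[of "T a"] by (simp add: S_T)

lemma sw_T:
  assumes f: "bilin f"
  shows "sw (T a) f = sw a (\<lambda>x y. f (T y) (T x))"
proof -
  have "bilin (\<lambda>x y. f (T y) (T x))"
    by (intro bilinI lin_comp[OF bilin_left[OF f]] lin_comp[OF bilin_right[OF f]] lin_T lin_id)
  then show ?thesis using sw_S[of "\<lambda>x y. f (T y) (T x)" "T a"] by (simp add: S_T T_S)
qed

lemma sw_T_left: "lin f \<Longrightarrow> sw a (\<lambda>x y. f (T y * x)) = scale (counit a) (f 1)"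
  using sw_S_left[of "\<lambda>t. f (T t)" a] lin_comp[OF _ lin_T[OF lin_id], of f] by (simp add: T_mult T_S T_1)

lemma sw_T_right: "lin f \<Longrightarrow> sw a (\<lambda>x y. f (y * T x)) = scale (counit a) (f 1)"
  using sw_S_right[of "\<lambda>t. f (T t)" a] lin_comp[OF _ lin_T[OF lin_id], of f] by (simp add: T_mult T_S T_1)

lemma sw_T_left': "sw a (\<lambda>x y. T y * x) = scale (counit a) 1"
    "sw a (\<lambda>x y. T y * (x * c)) = scale (counit a) c"
  using sw_T_left[OF lin_id, of a] sw_T_left[OF lin_mult_left[OF lin_id, of c], of a]
  by (simp_all add: mult.assoc)

lemma sw_T_right': "sw a (\<lambda>x y. y * T x) = scale (counit a) 1"
    "sw a (\<lambda>x y. y * (T x * c)) = scale (counit a) c"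
  using sw_T_right[OF lin_id, of a] sw_T_right[OF lin_mult_left[OF lin_id, of c], of a]
  by (simp_all add: mult.assoc)

lemmas cancelT = cancel sw_T_left' sw_T_right'

lemma L_nondegenerate: "(\<And>x. L (h * x) = 0) \<Longrightarrow> h = 0"
  using L_nondegenerate_S[of "T h"] S_T[of h] S_0 by simp

text \<open>
  Reading a functional as its vector of values on a basis turns \<open>h \<mapsto> \<lambda>(S(h) \<cdot>)\<close> into an endomorphism
  of \<open>H\<close>. It is injective by nondegeneracy, hence surjective.
\<close>

lemma functional_representable:
  assumes f: "Vector_Spaces.linear scale (*) f"
  obtains h where "\<And>x. l (S h * x) = f x"
proof -
  obtain C where C: "finite C" "independent C" "span C = UNIV"
    using finite_dimensional_basis[OF fd] by blast
  have lin_ext: "u = v" if "Vector_Spaces.linear scale (*) u" "Vector_Spaces.linear scale (*) v"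
    "\<And>c. c \<in> C \<Longrightarrow> u c = v c" for u v :: "'h \<Rightarrow> 'k"
  proof -
    interpret k: vector_space "(*) :: 'k \<Rightarrow> 'k \<Rightarrow> 'k"
      using that(1) by (simp add: Vector_Spaces.linear_iff)
    interpret vector_space_pair scale "(*) :: 'k \<Rightarrow> 'k \<Rightarrow> 'k" by unfold_locales
    show ?thesis using linear_eq_on[OF that(1,2), of _ C] that(3) C(3) by blast
  qed
  have lh: "Vector_Spaces.linear scale (*) (\<lambda>x. l (S h * x))" for h
    by (intro linear_l_comp multilin)
  let ?\<Phi> = "\<lambda>h. \<Sum>c\<in>C. scale (l (S h * c)) c"
  have "lin ?\<Phi>"
    by (rule linI)
      (simp_all add: S_add S_scale distrib_right
        scale_mult_left[symmetric] l_add l_scale scale_left_distrib sum.distrib scale_sum_right)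
  moreover have "h = 0" if "?\<Phi> h = 0" for h
  proof (rule L_nondegenerate_S)
    fix x
    have "l (S h * c) = 0" if "c \<in> C" for c
      by (rule independentD[OF C(2,1) subset_refl \<open>?\<Phi> h = 0\<close> that])
    moreover have "Vector_Spaces.linear scale (*) (\<lambda>x. 0 :: 'k)"
      using l_linear by (simp add: Vector_Spaces.linear_iff)
    ultimately have "(\<lambda>x. l (S h * x)) = (\<lambda>x. 0)" by (intro lin_ext lh)
    then have "l (S h * x) = 0" by (rule fun_cong)
    then show "L (S h * x) = 0" by (simp add: L_def)
  qed
  ultimately have surj: "surj ?\<Phi>" by (rule finite_dimensional_inj_imp_surj[OF fd])
  obtain h where h: "(\<Sum>c\<in>C. scale (f c) c) = ?\<Phi> h"
    using surjD[OF surj, of "\<Sum>c\<in>C. scale (f c) c"] by (rule exE)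
  have 0: "(\<Sum>c\<in>C. scale (l (S h * c) - f c) c) = 0"
    using h by (simp add: scale_left_diff_distrib sum_subtractf)
  have "l (S h * c) = f c" if "c \<in> C" for c
    using independentD[OF C(2,1) subset_refl 0 that] by simp
  then have "(\<lambda>x. l (S h * x)) = f" by (intro lin_ext lh f)
  then have "l (S h * x) = f x" for x by (rule fun_cong)
  then show ?thesis by (rule that)
qed

section \<open>Radford's formula for the fourth power of the antipode\<close>

text \<open>
  The element \<open>\<Lambda>\<close> with \<open>\<lambda>(S(\<Lambda>)x) = \<epsilon>(x)\<close> is a left integral, because \<open>\<lambda>(S(h\<Lambda>)x) = \<epsilon>(h)\<epsilon>(x)\<close>.
\<close>

lemma two_sided_integral:
  "\<exists>\<Lambda>. (\<forall>h. h * \<Lambda> = scale (counit h) \<Lambda>) \<and> (\<forall>h. \<Lambda> * h = scale (counit h) \<Lambda>) \<and> \<Lambda> \<noteq> 0"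
proof -
  obtain \<Lambda> where \<Lambda>: "\<And>x. l (S \<Lambda> * x) = counit x"
    using functional_representable[OF counit_linear] by blast
  have "h * \<Lambda> = scale (counit h) \<Lambda>" for h
  proof -
    have "h * \<Lambda> - scale (counit h) \<Lambda> = 0"
    proof (rule L_nondegenerate_S)
      fix x
      show "L (S (h * \<Lambda> - scale (counit h) \<Lambda>) * x) = 0"
        by (simp add: lin_diff[of "\<lambda>t. L (S t * x)"] lin_scale[of "\<lambda>t. L (S t * x)"] multilinL)
           (simp add: L_def S_mult mult.assoc \<Lambda> counit_mult counit_S)
    qed
    then show ?thesis by simp
  qed
  moreover from this have "\<Lambda> * h = scale (counit h) \<Lambda>" for h
    using unimod by (simp add: unimodular_def left_integral_def right_integral_def)
  moreover have "\<Lambda> \<noteq> 0"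
    using \<Lambda>[of 1] S_0 l_scale[of 0 0] by (auto simp: counit_one)
  ultimately show ?thesis by blast
qed

text \<open>
  The formulas are the two shift lemmas at an integral \<open>\<Lambda>\<close>. If \<open>\<lambda>(\<Lambda>)\<close> were zero, all contractions
  of \<open>\<Delta>(\<Lambda>)\<close> would vanish, in particular \<open>\<epsilon>(\<Lambda>\<^sub>1)\<Lambda>\<^sub>2 = \<Lambda>\<close>, which is not zero.
\<close>

lemma Frobenius_formulas:
  "\<exists>\<Lambda>. l \<Lambda> \<noteq> 0 \<and> (\<forall>h. sw \<Lambda> (\<lambda>x y. L (S h * x) * y) = scale (l \<Lambda>) h)
    \<and> (\<forall>h. sw \<Lambda> (\<lambda>x y. L (x * h) * y) = scale (l \<Lambda>) (S h))"
proof -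
  obtain \<Lambda> where \<Lambda>: "\<And>h. h * \<Lambda> = scale (counit h) \<Lambda>" "\<And>h. \<Lambda> * h = scale (counit h) \<Lambda>" "\<Lambda> \<noteq> 0"
    using two_sided_integral by blast
  have 1: "sw \<Lambda> (\<lambda>x y. L (S h * x) * y) = scale (l \<Lambda>) h" for h
    unfolding L_shift_left
    by (simp add: \<Lambda> L_scale scale_mult_left[symmetric] sw_counit_right multilinL counit_S L_mult
        del: scale_scale)
  have 2: "sw \<Lambda> (\<lambda>x y. L (x * h) * y) = scale (l \<Lambda>) (S h)" for h
    unfolding L_shift_right
    by (simp add: \<Lambda> L_scale scale_mult_left[symmetric] sw_counit_left multilinL L_mult
        del: scale_scale)
  have "l \<Lambda> \<noteq> 0"
  proof
    assume "l \<Lambda> = 0"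
    obtain h where h: "\<And>x. l (S h * x) = counit x"
      using functional_representable[OF counit_linear] by blast
    have "sw \<Lambda> (\<lambda>x y. L (S h * x) * y) = \<Lambda>"
      using sw_counit_left[OF lin_id, of \<Lambda>] by (simp add: L_mult h)
    with \<open>l \<Lambda> = 0\<close> \<Lambda>(3) 1[of h] show False by simp
  qed
  with 1 2 show ?thesis by blast
qed

text \<open>
  The Nakayama automorphism of \<open>\<lambda>\<close> is \<open>S\<^sup>2\<close>: the functionals \<open>x \<mapsto> \<lambda>(xb)\<close> and \<open>x \<mapsto> \<lambda>(S\<^sup>2(b)x)\<close> have
  the same contraction with \<open>\<Delta>(\<Lambda>)\<close>, and contraction with \<open>\<Delta>(\<Lambda>)\<close> is injective on functionals.
\<close>

lemma L_mult_commute: "L (a * b) = L (S (S b) * a)"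
proof -
  obtain \<Lambda> where \<Lambda>: "l \<Lambda> \<noteq> 0" "\<And>h. sw \<Lambda> (\<lambda>x y. L (S h * x) * y) = scale (l \<Lambda>) h"
    "\<And>h. sw \<Lambda> (\<lambda>x y. L (x * h) * y) = scale (l \<Lambda>) (S h)" using Frobenius_formulas by blast
  have lin: "Vector_Spaces.linear scale (*) (\<lambda>x. l (x * b - S (S b) * x))"
    by (intro linear_l_comp lin_diff_fun multilin)
  obtain h where h: "\<And>x. l (S h * x) = l (x * b - S (S b) * x)"
    using functional_representable[OF lin] by blast
  have Lh: "L (S h * x) = L (x * b) - L (S (S b) * x)" for x
    using L_diff h by (metis L_def)
  have "scale (l \<Lambda>) h = sw \<Lambda> (\<lambda>x y. (L (x * b) - L (S (S b) * x)) * y)"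
    by (simp add: \<Lambda>(2)[symmetric] Lh)
  also have "\<dots> = sw \<Lambda> (\<lambda>x y. L (x * b) * y) - sw \<Lambda> (\<lambda>x y. L (S (S b) * x) * y)"
    by (simp add: sw_def case_prod_unfold left_diff_distrib sum_list_subtractf)
  also have "\<dots> = 0" by (simp add: \<Lambda>)
  finally have "h = 0" using \<Lambda>(1) by simp
  then show ?thesis
    using Lh[of a] S_0 L_0 by simp
qed

text \<open>
  Apply \<open>\<lambda>\<close> to \<open>\<lambda>(\<Lambda>\<^sub>1a)\<Lambda>\<^sub>2 = \<lambda>(\<Lambda>)S(a)\<close>, contracting \<open>\<Lambda>\<^sub>2\<close> first: \<open>\<Lambda>\<^sub>1\<lambda>(\<Lambda>\<^sub>2) = \<lambda>(\<Lambda>)g\<close>.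
\<close>

lemma L_S: "L (S a) = L (g * a)"
proof -
  obtain \<Lambda> where \<Lambda>: "l \<Lambda> \<noteq> 0" "\<And>h. sw \<Lambda> (\<lambda>x y. L (x * h) * y) = scale (l \<Lambda>) (S h)"
    using Frobenius_formulas by blast
  have "scale (l \<Lambda>) (L (S a)) = L (scale (l \<Lambda>) (S a))"
    by (simp only: L_scale)
  also have "\<dots> = L (sw \<Lambda> (\<lambda>x y. L (x * a) * y))" by (simp add: \<Lambda>)
  also have "\<dots> = sw \<Lambda> (\<lambda>x y. L (x * L y * a))"
  proof -
    have "L (L u * y) = scale (l y) (L u)" for u y by (simp add: L_mult_L mult_L)
    moreover have "L (x * L y * a) = scale (l y) (L (x * a))" for x y
      by (simp add: mult_L L_scale scale_mult_left[symmetric])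
    ultimately show ?thesis by (simp add: sw_lin[OF lin_L[OF lin_id]])
  qed
  also have "\<dots> = L (sw \<Lambda> (\<lambda>x y. x * L y) * a)"
    by (rule sw_lin[symmetric]) (simp add: multilinL)
  also have "\<dots> = scale (l \<Lambda>) (L (g * a))"
    by (simp add: L_distinguished L_mult scale_mult_left[symmetric]) (simp add: L_def l_scale)
  finally show ?thesis using \<Lambda>(1) by simp
qed

lemma S4: "S (S (S (S a))) * g = g * a"
proof -
  have "g * a - S (S (S (S a))) * g = 0"
  proof (rule L_nondegenerate)
    fix b
    have "L (g * (a * b)) = L (S (S (S a)) * S b)"
      by (simp add: L_S[symmetric] S_mult L_mult_commute[of "S b"])
    also have "\<dots> = L (g * (b * S (S a)))" by (simp add: L_S[symmetric] S_mult)
    also have "\<dots> = L (S (S (S (S a))) * g * b)"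
      using L_mult_commute[of "g * b" "S (S a)"] by (simp add: mult.assoc)
    finally show "L ((g * a - S (S (S (S a))) * g) * b) = 0"
      by (simp add: left_diff_distrib L_diff mult.assoc)
  qed
  then show ?thesis by simp
qed

section \<open>The commutators and their subalgebra\<close>

text \<open>
  The element \<open>g\<close> is group-like: comparing \<open>\<Delta>\<close> of \<open>a\<^sub>1\<lambda>(a\<^sub>2) = \<lambda>(a)g\<close> with the same law inside
  \<open>a\<^sub>1 \<otimes> a\<^sub>2\<lambda>(a\<^sub>3)\<close> gives \<open>\<lambda>(a)\<Delta>(g) = \<lambda>(a) g \<otimes> g\<close>.
\<close>

lemma sw_g:
  assumes f: "bilin f" shows "sw g f = f g g"
proof -
  note f' = lin_comp[OF bilin_left[OF f]] lin_comp[OF bilin_right[OF f]]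
  obtain a where a: "l a \<noteq> 0" using nonzero by blast
  have "scale (l a) (sw g f) = sw (L a * g) f"
    by (simp add: L_mult sw_scale_arg[OF f])
  also have "\<dots> = sw (sw a (\<lambda>x y. x * L y)) f" by (simp only: L_distinguished)
  also have "\<dots> = sw a (\<lambda>x y. sw (x * L y) f)"
    by (rule sw_lin[OF lin_sw_arg[OF f lin_id]])
  also have "\<dots> = sw a (\<lambda>x y. sw x (\<lambda>u v. scale (l y) (f u v)))"
    by (simp add: mult_L sw_scale_arg[OF f] sw_pull_scale)
  also have "\<dots> = sw a (\<lambda>x y. sw y (\<lambda>u v. scale (l v) (f x u)))"
    by (simp add: sw_assoc multilinL f')
  also have "\<dots> = sw a (\<lambda>x y. f x (sw y (\<lambda>u v. u * L v)))"
    by (simp only: sw_lin[OF bilin_right[OF f]]) (simp only: mult_L lin_scale[OF bilin_right[OF f]])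
  also have "\<dots> = sw a (\<lambda>x y. f (x * L y) g)"
    by (simp only: L_distinguished) (simp add: mult_L L_mult lin_scale[OF bilin_right[OF f]]
        lin_scale[OF bilin_left[OF f]])
  also have "\<dots> = scale (l a) (f g g)"
    by (simp add: sw_lin[OF bilin_left[OF f], symmetric] L_distinguished L_mult
        lin_scale[OF bilin_left[OF f]])
  finally show ?thesis using a by simp
qed

lemma counit_g: "counit g = 1"
proof -
  obtain a where a: "l a \<noteq> 0" using nonzero by blast
  have "scale (l a) g = sw a (\<lambda>x y. scale (l y) x)"
    using L_distinguished[of a] by (simp add: L_mult mult_L)
  then have "scale (counit (scale (l a) g)) 1 = sw a (\<lambda>x y. scale (counit (scale (l y) x)) 1)"
    using sw_lin[of "\<lambda>x. scale (counit x) 1" a "\<lambda>x y. scale (l y) x"] by (simp add: multilin)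
  also have "\<dots> = sw a (\<lambda>x y. scale (counit x) (scale (l y) 1))"
    by (simp add: counit_scale mult.commute)
  also have "\<dots> = scale (l a) 1" by (simp add: sw_counit_left multilinL del: scale_scale)
  finally have "l a * counit g = l a"
    by (simp add: counit_scale)
  then show ?thesis using a by simp
qed

abbreviation "G \<equiv> S g"

lemma g_G: "g * G = 1" and G_g: "G * g = 1"
  using sw_S_right'(1)[of g] sw_S_left'(1)[of g]
  by (simp_all add: sw_g multilin counit_g)

lemma G_g': "G * (g * x) = x"
  by (simp add: mult.assoc[symmetric] G_g)

lemma alg_inverse_g: "alg_inverse g = G"
  unfolding alg_inverse_def
  by (rule the_equality) (auto simp: g_G G_g, metis g_G mult.assoc mult_1_left)

lemma S4_conj: "S (S (S (S a))) = g * (a * G)"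
  using arg_cong[OF S4[of a], of "\<lambda>x. x * G"] by (simp add: mult.assoc g_G)

lemma G_SS: "G * (S (S a) * x) = T (T a) * (G * x)"
proof -
  have "G * (S (S a) * x) = G * (S (S (S (S (T (T a))))) * x)" by (simp add: S_T)
  also have "\<dots> = T (T a) * (G * x)" by (simp add: S4_conj mult.assoc G_g')
  finally show ?thesis .
qed

lemma sw_TT: "sw a (\<lambda>x y. T x * (T (T y) * c)) = scale (counit a) c"
  using sw_T_left[of "\<lambda>t. T t * c" a] by (simp add: multilinT T_mult T_1 mult.assoc)

definition com :: "'h \<Rightarrow> 'h \<Rightarrow> 'h" where
  "com a b = sw a (\<lambda>a1 a2. sw b (\<lambda>b1 b2. a1 * (S (S b1) * (S a2 * (T b2 * G)))))"

lemma commutator_eq: "commutator g a b = com a b"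
  by (simp add: commutator_def com_def sw_def alg_inverse_g mult.assoc)

lemma com_1_1: "com 1 1 = G"
  by (simp add: com_def sw_1 multilinT S_1 T_1)

lemma counit_com: "counit (com a b) = counit a * counit b"
proof -
  have 1: "(\<Sum>(x, y)\<leftarrow>comult h. counit x * (c * counit y)) = c * counit h" for h c
  proof -
    have "(\<Sum>(x, y)\<leftarrow>comult h. counit x * (c * counit y)) = counit (sw h (\<lambda>x y. scale (counit x) (scale c y)))"
      by (simp add: counit_sw counit_scale del: scale_scale)
    then show ?thesis by (simp add: sw_counit_left multilin counit_scale del: scale_scale)
  qed
  have "counit (com a b) = (\<Sum>(a1, a2)\<leftarrow>comult a. \<Sum>(b1, b2)\<leftarrow>comult b.
      counit b1 * ((counit a1 * counit a2) * counit b2))"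
    by (simp add: com_def counit_sw counit_mult counit_S counit_T counit_g ac_simps)
  also have "\<dots> = (\<Sum>(a1, a2)\<leftarrow>comult a. counit a1 * counit a2 * counit b)"
    by (simp only: 1)
  also have "\<dots> = (\<Sum>(a1, a2)\<leftarrow>comult a. counit a1 * (counit b * counit a2))"
    by (simp add: ac_simps)
  also have "\<dots> = counit b * counit a" by (rule 1)
  finally show ?thesis by (simp add: mult.commute)
qed

text \<open>
  Since \<open>S\<close> and \<open>S\<^sup>-\<^sup>1\<close> reverse coproducts, the second tensor factor of \<open>\<Delta>{a, b}\<close> is assembled from
  the middle legs of \<open>a\<close> and \<open>b\<close>, and is again a commutator.
\<close>

lemma sw_com:
  assumes \<beta>: "bilin \<beta>"
  shows "sw (com a b) \<beta> = sw a (\<lambda>a1 t. sw t (\<lambda>c a4. sw b (\<lambda>b1 t'. sw t' (\<lambda>d b4.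
    \<beta> (a1 * (S (S b1) * (S a4 * (T b4 * G)))) (com c d)))))"
proof -
  note \<beta>' = lin_comp[OF bilin_left[OF \<beta>]] lin_comp[OF bilin_right[OF \<beta>]]
  let ?F = "\<lambda>p q u v r s m n. \<beta> (p * (S (S r) * (S v * (T n * G)))) (q * (S (S s) * (S u * (T m * G))))"
  have "sw (com a b) \<beta> = sw a (\<lambda>x y. sw b (\<lambda>z w.
      sw (x * (S (S z) * (S y * (T w * G)))) \<beta>))"
    unfolding com_def by (simp add: sw_lin[OF lin_sw_arg[OF \<beta> lin_id]])
  also have "\<dots> = sw a (\<lambda>x y. sw b (\<lambda>z w. sw x (\<lambda>p q. sw z (\<lambda>r s. sw y (\<lambda>u v. sw w (\<lambda>m n.
      ?F p q u v r s m n))))))"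
    by (simp add: sw_mult sw_S sw_T sw_g multilinT \<beta>' \<beta>)
  also have "\<dots> = sw a (\<lambda>x y. sw x (\<lambda>p q. sw b (\<lambda>z w. sw z (\<lambda>r s. sw y (\<lambda>u v. sw w (\<lambda>m n.
      ?F p q u v r s m n))))))"
    by (rule sw_cong, rule sw_swap)
  also have "\<dots> = sw a (\<lambda>x y. sw x (\<lambda>p q. sw b (\<lambda>z w. sw y (\<lambda>u v. sw z (\<lambda>r s. sw w (\<lambda>m n.
      ?F p q u v r s m n))))))"
    by (rule sw_cong, rule sw_cong, rule sw_cong, rule sw_swap)
  also have "\<dots> = sw a (\<lambda>x y. sw x (\<lambda>p q. sw y (\<lambda>u v. sw b (\<lambda>z w. sw z (\<lambda>r s. sw w (\<lambda>m n.
      ?F p q u v r s m n))))))"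
    by (rule sw_cong, rule sw_cong, rule sw_swap)
  also have "\<dots> = sw a (\<lambda>x y. sw x (\<lambda>p q. sw y (\<lambda>u v. sw b (\<lambda>r t'. sw t' (\<lambda>d n. sw d (\<lambda>s m.
      ?F p q u v r s m n))))))"
    by (rule sw_cong, rule sw_cong, rule sw_cong, rule sw_middle) (intro multilinT \<beta>')+
  also have "\<dots> = sw a (\<lambda>p t. sw t (\<lambda>c v. sw c (\<lambda>q u. sw b (\<lambda>r t'. sw t' (\<lambda>d n. sw d (\<lambda>s m.
      ?F p q u v r s m n))))))"
    by (rule sw_middle) (intro multilinT \<beta>')+
  also have "\<dots> = sw a (\<lambda>p t. sw t (\<lambda>c v. sw b (\<lambda>r t'. sw c (\<lambda>q u. sw t' (\<lambda>d n. sw d (\<lambda>s m.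
      ?F p q u v r s m n))))))"
    by (rule sw_cong, rule sw_cong, rule sw_swap)
  also have "\<dots> = sw a (\<lambda>p t. sw t (\<lambda>c v. sw b (\<lambda>r t'. sw t' (\<lambda>d n. sw c (\<lambda>q u. sw d (\<lambda>s m.
      ?F p q u v r s m n))))))"
    by (rule sw_cong, rule sw_cong, rule sw_cong, rule sw_swap)
  also have "\<dots> = sw a (\<lambda>a1 t. sw t (\<lambda>c a4. sw b (\<lambda>b1 t'. sw t' (\<lambda>d b4.
    \<beta> (a1 * (S (S b1) * (S a4 * (T b4 * G)))) (com c d)))))"
    unfolding com_def by (simp add: sw_lin[OF bilin_right[OF \<beta>]])
  finally show ?thesis .
qed

text \<open>
  In the product \<open>{h\<^sub>1a, b\<^sub>1} {S\<^sup>2(b\<^sub>2), S\<^sup>2(h\<^sub>2)} g\<close> the formula for \<open>S\<^sup>4\<close> turns the inner factors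
  \<open>S\<^sup>-\<^sup>1(b\<^sub>2)g\<^sup>-\<^sup>1S\<^sup>2(b\<^sub>3)S\<^sup>4(h\<^sub>3)\<close> into \<open>S\<^sup>-\<^sup>1(b\<^sub>2)S\<^sup>-\<^sup>2(b\<^sub>3)h\<^sub>3g\<^sup>-\<^sup>1\<close>. The two middle legs of \<open>b\<close> then cancel,
  after them \<open>S(h\<^sub>2)\<close> meets \<open>h\<^sub>3\<close> and they cancel as well. The arguments of the second commutator
  are chosen to make this happen.
\<close>

lemma adjoint_com:
  "adjoint h (com a b) = sw h (\<lambda>h1 h2. sw b (\<lambda>b1 b2.
     com (h1 * a) b1 * (com (S (S b2)) (S (S h2)) * g)))"
proof -
  let ?A = "\<lambda>p q r s. sw a (\<lambda>x y. p * (x * (S (S r) * (S y * (S q * (T s * G))))))"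
  let ?B = "\<lambda>u v m n. S (S u) * (g * (m * (G * (S (S (S v)) * S n))))"
  have 1: "com (h1 * a) b1 = sw h1 (\<lambda>p q. sw b1 (\<lambda>r s. ?A p q r s))" for h1 b1
    by (simp add: com_def sw_mult multilinT S_mult mult.assoc sw_swap[of b1 a])
  have 2: "com (S (S b2)) (S (S h2)) * g = sw b2 (\<lambda>u v. sw h2 (\<lambda>m n. ?B u v m n))" for b2 h2
    by (simp add: com_def sw_S multilinT sw_pull_right[symmetric] mult.assoc S4_conj T_S G_g)
  have 3: "?A p q r s * ?B u v m n = sw a (\<lambda>x y. p * (x * (S (S r) * (S y * (S q *
      (T s * (T (T u) * (m * (T v * (G * S n))))))))))" (is "_ = ?K p q m n r s u v")
    for p q r s u v m n
  proof -
    have "G * ?B u v m n = T (T u) * (m * (T v * (G * S n)))"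
      using G_SS[of "S v" "S n"] by (simp add: G_SS G_g' T_S)
    then show ?thesis by (simp add: sw_pull_right[symmetric] mult.assoc)
  qed
  have "sw h (\<lambda>h1 h2. sw b (\<lambda>b1 b2. com (h1 * a) b1 * (com (S (S b2)) (S (S h2)) * g)))
    = sw h (\<lambda>h1 h2. sw b (\<lambda>b1 b2. sw h1 (\<lambda>p q. sw b1 (\<lambda>r s. sw b2 (\<lambda>u v. sw h2 (\<lambda>m n.
      ?K p q m n r s u v))))))"
    by (simp only: 1 2 sw_times2 3)
  also have "\<dots> = sw h (\<lambda>h1 h2. sw h1 (\<lambda>p q. sw b (\<lambda>b1 b2. sw b1 (\<lambda>r s. sw b2 (\<lambda>u v. sw h2 (\<lambda>m n.
      ?K p q m n r s u v))))))"
    by (rule sw_cong, rule sw_swap)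
  also have "\<dots> = sw h (\<lambda>h1 h2. sw h1 (\<lambda>p q. sw b (\<lambda>b1 b2. sw b1 (\<lambda>r s. sw h2 (\<lambda>m n. sw b2 (\<lambda>u v.
      ?K p q m n r s u v))))))"
    by (rule sw_cong, rule sw_cong, rule sw_cong, rule sw_cong, rule sw_swap)
  also have "\<dots> = sw h (\<lambda>h1 h2. sw h1 (\<lambda>p q. sw b (\<lambda>b1 b2. sw h2 (\<lambda>m n. sw b1 (\<lambda>r s. sw b2 (\<lambda>u v.
      ?K p q m n r s u v))))))"
    by (rule sw_cong, rule sw_cong, rule sw_cong, rule sw_swap)
  also have "\<dots> = sw h (\<lambda>h1 h2. sw h1 (\<lambda>p q. sw h2 (\<lambda>m n. sw b (\<lambda>b1 b2. sw b1 (\<lambda>r s. sw b2 (\<lambda>u v.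
      ?K p q m n r s u v))))))"
    by (rule sw_cong, rule sw_cong, rule sw_swap)
  \<comment> \<open>the legs of \<open>h\<close> are now in front, so that those of \<open>b\<close> can be regrouped\<close>
  also have "\<dots> = sw h (\<lambda>h1 h2. sw h1 (\<lambda>p q. sw h2 (\<lambda>m n. sw b (\<lambda>r t. sw t (\<lambda>c v. sw c (\<lambda>s u.
      ?K p q m n r s u v))))))"
    by (rule sw_cong, rule sw_cong, rule sw_cong, rule sw_middle) (intro multilinT)+
  also have "\<dots> = sw h (\<lambda>h1 h2. sw h1 (\<lambda>p q. sw h2 (\<lambda>m n. sw b (\<lambda>r v.
      sw a (\<lambda>x y. p * (x * (S (S r) * (S y * (S q * (m * (T v * (G * S n)))))))))))) "
  proof -
    have "sw c (\<lambda>s u. ?K p q m n r s u v) = scale (counit c)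
      (sw a (\<lambda>x y. p * (x * (S (S r) * (S y * (S q * (m * (T v * (G * S n)))))))))" for c p q m n r v
      by (subst sw_swap) (simp add: sw_TT sw_pull_left sw_pull_scale scale_mult_right[symmetric])
    then show ?thesis by (simp add: sw_counit_left multilinT)
  qed
  also have "\<dots> = sw h (\<lambda>p t. sw t (\<lambda>c n. sw c (\<lambda>q m. sw b (\<lambda>r v.
      sw a (\<lambda>x y. p * (x * (S (S r) * (S y * (S q * (m * (T v * (G * S n)))))))))))) "
    by (rule sw_middle) (intro multilinT)+
  also have "\<dots> = sw h (\<lambda>p n. sw b (\<lambda>r v.
      sw a (\<lambda>x y. p * (x * (S (S r) * (S y * (T v * (G * S n))))))))"
  proof -
    have "sw c (\<lambda>q m. sw b (\<lambda>r v. sw a (\<lambda>x y. p * (x * (S (S r) * (S y * (S q * (m * (T v * (G * S n)))))))))) =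
      scale (counit c) (sw b (\<lambda>r v. sw a (\<lambda>x y. p * (x * (S (S r) * (S y * (T v * (G * S n))))))))"
      for c p n
      by (subst sw_swap, subst sw_swap)
         (simp add: sw_S_left' sw_pull_left sw_pull_scale scale_mult_right[symmetric])
    then show ?thesis by (simp add: sw_counit_left multilinT)
  qed
  also have "\<dots> = adjoint h (com a b)"
    by (simp add: adjoint_def com_def sw_swap[of b a] sw_pull_left[symmetric] sw_pull_right[symmetric]
        mult.assoc)
  finally show ?thesis ..
qed

text \<open>
  \<open>\<Delta>(x) \<in> H \<otimes> A\<close>, with tensors compared through bilinear maps.
\<close>

definition right_tensor :: "'h set \<Rightarrow> 'h \<Rightarrow> bool" where
  "right_tensor A x \<longleftrightarrow>
     (\<exists>ts. set ts \<subseteq> UNIV \<times> A \<and> (\<forall>\<beta>. bilin \<beta> \<longrightarrow> sw x \<beta> = (\<Sum>(x, y)\<leftarrow>ts. \<beta> x y)))"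

lemma right_tensor_iff:
  "right_tensor A x \<longleftrightarrow> (\<exists>ts. set ts \<subseteq> UNIV \<times> A \<and> tensor_eq (comult x) ts)"
  unfolding right_tensor_def sw_def
  using tensor_eqI[of 1 "comult x"] tensor_eq_bilin[of "comult x"] by (metis zero_neq_one)

lemma subalgebra_right_tensor:
  assumes A: "subalgebra A" shows "subalgebra {x. right_tensor A x}"
proof -
  have one: "1 \<in> A" and mult: "\<And>x y. x \<in> A \<Longrightarrow> y \<in> A \<Longrightarrow> x * y \<in> A"
    using A by (auto simp: subalgebra_def)
  have 0: "right_tensor A 0"
    unfolding right_tensor_def
    by (rule exI[of _ "[]"]) (simp add: lin_0[OF lin_sw_arg[OF _ lin_id]])
  have 1: "right_tensor A 1"
    unfolding right_tensor_def by (rule exI[of _ "[(1, 1)]"]) (simp add: sw_1 one)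
  have add: "right_tensor A (x + y)" if "right_tensor A x" "right_tensor A y" for x y
  proof -
    from that obtain ts us where "set ts \<subseteq> UNIV \<times> A" "set us \<subseteq> UNIV \<times> A"
      "\<And>\<beta>. bilin \<beta> \<Longrightarrow> sw x \<beta> = (\<Sum>(x, y)\<leftarrow>ts. \<beta> x y)"
      "\<And>\<beta>. bilin \<beta> \<Longrightarrow> sw y \<beta> = (\<Sum>(x, y)\<leftarrow>us. \<beta> x y)"
      unfolding right_tensor_def by metis
    then show ?thesis
      unfolding right_tensor_def by (intro exI[of _ "ts @ us"]) (auto simp: sw_add_arg)
  qed
  have scale: "right_tensor A (scale c x)" if "right_tensor A x" for c x
  proof -
    from that obtain ts where ts: "set ts \<subseteq> UNIV \<times> A"
      "\<And>\<beta>. bilin \<beta> \<Longrightarrow> sw x \<beta> = (\<Sum>(x, y)\<leftarrow>ts. \<beta> x y)"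
      unfolding right_tensor_def by metis
    have "sw (scale c x) \<beta> = (\<Sum>(x, y)\<leftarrow>map (\<lambda>(x, y). (scale c x, y)) ts. \<beta> x y)"
      if \<beta>: "bilin \<beta>" for \<beta>
      by (simp add: sw_scale_arg[OF \<beta>] ts(2)[OF \<beta>] case_prod_unfold comp_def
          lin_scale[OF bilin_left[OF \<beta>]] lin_sum_list[OF lin_scale_right[OF lin_id]])
    with ts(1) show ?thesis
      unfolding right_tensor_def by (intro exI[of _ "map (\<lambda>(x, y). (scale c x, y)) ts"]) auto
  qed
  have "right_tensor A (x * y)" if "right_tensor A x" "right_tensor A y" for x y
  proof -
    from that obtain ts us where ts: "set ts \<subseteq> UNIV \<times> A"
      "\<And>\<beta>. bilin \<beta> \<Longrightarrow> sw x \<beta> = (\<Sum>(x, y)\<leftarrow>ts. \<beta> x y)"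
      and us: "set us \<subseteq> UNIV \<times> A" "\<And>\<beta>. bilin \<beta> \<Longrightarrow> sw y \<beta> = (\<Sum>(x, y)\<leftarrow>us. \<beta> x y)"
      unfolding right_tensor_def by metis
    let ?vs = "[(p * r, q * s). (p, q) \<leftarrow> ts, (r, s) \<leftarrow> us]"
    have "sw (x * y) \<beta> = (\<Sum>(x, y)\<leftarrow>?vs. \<beta> x y)" if \<beta>: "bilin \<beta>" for \<beta>
    proof -
      note \<beta>' = lin_comp[OF bilin_left[OF \<beta>]] lin_comp[OF bilin_right[OF \<beta>]]
      have "sw (x * y) \<beta> = sw x (\<lambda>p q. sw y (\<lambda>r s. \<beta> (p * r) (q * s)))"
        by (rule sw_mult[OF \<beta>])
      also have "\<dots> = (\<Sum>(p, q)\<leftarrow>ts. sw y (\<lambda>r s. \<beta> (p * r) (q * s)))"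
        by (rule ts(2)) (intro multilin \<beta>')
      also have "\<dots> = (\<Sum>(p, q)\<leftarrow>ts. \<Sum>(r, s)\<leftarrow>us. \<beta> (p * r) (q * s))"
        by (subst us(2)) (intro multilin \<beta>', rule refl)
      finally show ?thesis by (simp add: sum_list_concat_map case_prod_unfold comp_def)
    qed
    moreover have "set ?vs \<subseteq> UNIV \<times> A" using ts(1) us(1) mult by auto
    ultimately show ?thesis unfolding right_tensor_def by (intro exI[of _ ?vs]) simp
  qed
  with 0 1 add scale show ?thesis by (auto simp: subalgebra_def subspace_def)
qed

lemma right_tensor_com: 
  assumes "\<And>a b. com a b \<in> A" shows "right_tensor A (com a b)"
proof -
  let ?ts = "[(a1 * (S (S b1) * (S a4 * (T b4 * G))), com c d).
    (a1, t) \<leftarrow> comult a, (c, a4) \<leftarrow> comult t, (b1, t') \<leftarrow> comult b, (d, b4) \<leftarrow> comult t']"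
  have "sw (com a b) \<beta> = (\<Sum>(x, y)\<leftarrow>?ts. \<beta> x y)" if "bilin \<beta>" for \<beta>
    by (subst sw_com[OF that]) (simp add: sw_def sum_list_concat_map case_prod_unfold comp_def)
  moreover have "set ?ts \<subseteq> UNIV \<times> A" using assms by auto
  ultimately show ?thesis unfolding right_tensor_def by (intro exI[of _ ?ts]) simp
qed

lemma subalgebra_commutator_subalgebra: "subalgebra (commutator_subalgebra g)"
  unfolding commutator_subalgebra_def
  by (rule hull_in) (auto simp: subalgebra_def subspace_def)

lemma com_in: "com a b \<in> commutator_subalgebra g"
  unfolding commutator_subalgebra_def by (rule hull_inc) (auto simp: commutator_eq)

lemma commutator_subalgebra_minimal:
  assumes "subalgebra A" "\<And>a b. com a b \<in> A" "x \<in> commutator_subalgebra g" shows "x \<in> A"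
  using hull_minimal[of "{commutator g a b | a b. True}" A subalgebra] assms
  unfolding commutator_subalgebra_def by (auto simp: commutator_eq)

text \<open>
  Multiplication by \<open>x\<close> is an injective endomorphism of the finite-dimensional space \<open>A\<close>, hence
  hits \<open>1\<close>.
\<close>

lemma subalgebra_inverse_closed:
  assumes A: "subalgebra A" and x: "x \<in> A" and inv: "y * x = 1" shows "y \<in> A"
proof -
  have sub: "subspace A" using A by (simp add: subalgebra_def)
  obtain C where C: "finite C" "independent C" "span C = UNIV"
    using finite_dimensional_basis[OF fd] by blast
  interpret finite_dimensional_vector_space scale C
    by unfold_locales (use C in auto)
  interpret pair: finite_dimensional_vector_space_pair_1 scale C scale by unfold_locales
  let ?f = "\<lambda>z. x * z"
  have f: "Vector_Spaces.linear scale scale ?f"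
    using lin_mult_right[OF lin_id] by (simp add: lin_iff_linear)
  have "inj ?f" by (rule injI) (metis inv mult.assoc mult_1_left)
  then have "dim (?f ` A) = dim A" by (intro pair.dim_image_eq[OF f]) (auto intro: inj_on_subset)
  moreover have "?f ` A \<subseteq> A" using A x by (auto simp: subalgebra_def)
  moreover have "subspace (?f ` A)" using pair.linear_subspace_image[OF f sub] .
  ultimately have "?f ` A = A" using sub by (intro subspace_dim_equal) auto
  then obtain z where "z \<in> A" "x * z = 1" using A by (force simp: subalgebra_def)
  moreover from this have "z = y" by (metis inv mult.assoc mult_1_left mult_1_right)
  ultimately show ?thesis by simp
qed

lemma g_in: "g \<in> commutator_subalgebra g"
  using subalgebra_inverse_closed[OF subalgebra_commutator_subalgebra _ g_G] com_in[of 1 1]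
  by (simp add: com_1_1)

lemma adjoint_in:
  assumes "x \<in> commutator_subalgebra g" shows "adjoint h x \<in> commutator_subalgebra g"
proof -
  let ?N = "commutator_subalgebra g"
  let ?A = "{x. \<forall>h. adjoint h x \<in> ?N}"
  have sub: "subspace ?N" and one: "1 \<in> ?N" and mult: "\<And>x y. x \<in> ?N \<Longrightarrow> y \<in> ?N \<Longrightarrow> x * y \<in> ?N"
    using subalgebra_commutator_subalgebra by (auto simp: subalgebra_def)
  have "adjoint h (x * y) \<in> ?N" if "x \<in> ?A" "y \<in> ?A" for x y h
    unfolding adjoint_mult using that by (intro sw_in_subspace sub mult) auto
  moreover have "subspace ?A"
    unfolding subspace_def using lin_adjoint[OF lin_id]
    by (auto simp: lin_0 lin_add lin_scale subspace_0[OF sub] subspace_add[OF sub] subspace_scale[OF sub])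
  moreover have "1 \<in> ?A" by (simp add: adjoint_1 subspace_scale[OF sub] one)
  ultimately have "subalgebra ?A" unfolding subalgebra_def by blast
  moreover have "com a b \<in> ?A" for a b
    by (simp add: adjoint_com) (intro allI sw_in_subspace sub mult com_in g_in)
  ultimately show ?thesis using commutator_subalgebra_minimal[OF _ _ assms, of ?A] by blast
qed

lemma normal_commutator_subalgebra: "normal_left_coideal_subalgebra (commutator_subalgebra g)"
proof -
  let ?N = "commutator_subalgebra g"
  have "right_tensor ?N x" if "x \<in> ?N" for x
    using commutator_subalgebra_minimal[OF subalgebra_right_tensor[OF subalgebra_commutator_subalgebra] _ that]
      right_tensor_com[OF com_in] by blast
  moreover have "(\<Sum>(h1, h2)\<leftarrow>comult h. h1 * x * S h2) \<in> ?N" if "x \<in> ?N" for h x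
    using adjoint_in[OF that, of h] by (simp add: adjoint_def sw_def mult.assoc)
  ultimately show ?thesis
    unfolding normal_left_coideal_subalgebra_def left_coideal_subalgebra_def
    using subalgebra_commutator_subalgebra by (simp add: right_tensor_iff[symmetric])
qed

section \<open>The quotient by the left ideal of the augmentation\<close>

text \<open>
  The left ideal \<open>HA\<^sup>+\<close> is a right ideal since \<open>nk = k\<^sub>2 (S\<^sup>-\<^sup>1(k\<^sub>1) \<triangleright> n)\<close> for the adjoint action
  \<open>h \<triangleright> n = h\<^sub>1nS(h\<^sub>2)\<close>, which preserves \<open>A\<^sup>+\<close>. It is a coideal stable under \<open>S\<close> because of
  \<open>\<Delta>(n) = n\<^sub>1 \<otimes> (n\<^sub>2 - \<epsilon>(n\<^sub>2)1) + n \<otimes> 1\<close>, whose first summand is in \<open>H \<otimes> A\<^sup>+\<close>: applying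
  \<open>x \<otimes> y \<mapsto> S(x)y\<close> for \<open>\<epsilon>(n) = 0\<close> gives \<open>S(n) = - S(n\<^sub>1)(n\<^sub>2 - \<epsilon>(n\<^sub>2)1)\<close>.
\<close>

lemma hopf_ideal_left_ideal_plus:
  assumes A: "normal_left_coideal_subalgebra A"
  shows "hopf_ideal (left_ideal_plus A)"
proof -
  let ?I = "left_ideal_plus A"
  have sub: "subspace A" and one: "1 \<in> A"
    and coideal: "\<And>x. x \<in> A \<Longrightarrow> right_tensor A x"
    and normal: "\<And>h x. x \<in> A \<Longrightarrow> adjoint h x \<in> A"
    using A
    by (auto simp: normal_left_coideal_subalgebra_def left_coideal_subalgebra_def subalgebra_def
        right_tensor_iff adjoint_def sw_def mult.assoc)
  have I: "subspace ?I" unfolding left_ideal_plus_def by (rule subspace_span)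
  have gen: "h * n \<in> ?I" if "n \<in> A" "counit n = 0" for h n
    unfolding left_ideal_plus_def using that by (intro span_base) blast
  have ind: "f x \<in> V" if "x \<in> ?I" "lin f" "subspace V"
    "\<And>h n. n \<in> A \<Longrightarrow> counit n = 0 \<Longrightarrow> f (h * n) \<in> V" for f V x
    using that(1) unfolding left_ideal_plus_def
    by (rule span_lin_image[OF _ that(2,3)]) (use that(4) in blast)
  have left: "h * x \<in> ?I" if "x \<in> ?I" for h x
    by (rule ind[OF that lin_mult_right[OF lin_id] I]) (simp add: mult.assoc[symmetric] gen)
  have swap: "n * k = sw k (\<lambda>k1 k2. k2 * adjoint (T k1) n)" for n k
  proof -
    have "sw k (\<lambda>k1 k2. k2 * adjoint (T k1) n)
      = sw k (\<lambda>k1 k2. sw k1 (\<lambda>p q. k2 * (T q * (n * p))))"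
      by (simp add: adjoint_def sw_T multilinT S_T sw_pull_left[symmetric])
    also have "\<dots> = sw k (\<lambda>p r. sw r (\<lambda>q k2. k2 * (T q * (n * p))))"
      by (rule sw_assoc) (intro multilinT)
    also have "\<dots> = n * k"
      by (simp add: multilinT cancelT)
    finally show ?thesis ..
  qed
  have right: "x * k \<in> ?I" if "x \<in> ?I" for k x
  proof (rule ind[OF that lin_mult_left[OF lin_id] I])
    fix h n assume n: "n \<in> A" "counit n = 0"
    have "n * k \<in> ?I"
      unfolding swap[of n k] by (intro sw_in_subspace I gen normal n) (simp add: counit_adjoint n)
    then show "h * n * k \<in> ?I" by (simp add: mult.assoc left)
  qed
  have counit: "counit x = 0" if "x \<in> ?I" for x
  proof -
    have "scale (counit x) 1 \<in> {0 :: 'h}"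
      by (rule ind[OF that lin_counit[OF lin_id] subspace_single_0]) (simp add: counit_mult)
    then show ?thesis by simp
  qed
  have split: "\<exists>ts. set ts \<subseteq> UNIV \<times> A \<and> (\<forall>\<beta>. bilin \<beta> \<longrightarrow>
      sw n \<beta> = (\<Sum>(x, y)\<leftarrow>ts. \<beta> x (y - scale (counit y) 1)) + \<beta> n 1)" if n: "n \<in> A" for n
  proof -
    from coideal[OF n] obtain ts where ts: "set ts \<subseteq> UNIV \<times> A"
      "\<And>\<beta>. bilin \<beta> \<Longrightarrow> sw n \<beta> = (\<Sum>(x, y)\<leftarrow>ts. \<beta> x y)"
      unfolding right_tensor_def by metis
    have "sw n \<beta> = (\<Sum>(x, y)\<leftarrow>ts. \<beta> x (y - scale (counit y) 1)) + \<beta> n 1" if \<beta>: "bilin \<beta>" for \<beta>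
    proof -
      have "\<beta> n 1 = sw n (\<lambda>x y. scale (counit y) (\<beta> x 1))"
        by (rule sw_counit_right[symmetric]) (rule bilin_left[OF \<beta>])
      also have "\<dots> = (\<Sum>(x, y)\<leftarrow>ts. scale (counit y) (\<beta> x 1))"
        by (rule ts(2)) (intro multilin bilin_left[OF \<beta>])
      also have "\<dots> = (\<Sum>(x, y)\<leftarrow>ts. \<beta> x (scale (counit y) 1))"
        by (simp add: lin_scale[OF bilin_right[OF \<beta>]])
      finally show ?thesis
        by (simp add: ts(2)[OF \<beta>] lin_diff[OF bilin_right[OF \<beta>]] case_prod_unfold sum_list_subtractf)
    qed
    with ts(1) show ?thesis by blast
  qed
  have plus: "y - scale (counit y) 1 \<in> A" "counit (y - scale (counit y) 1) = 0" if "y \<in> A" for y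
    using that by (simp_all add: subspace_diff[OF sub] subspace_scale[OF sub] one counit_diff counit_scale counit_one)
  let ?D = "{x. \<exists>ts us. set ts \<subseteq> ?I \<times> UNIV \<and> set us \<subseteq> UNIV \<times> ?I \<and>
     (\<forall>\<beta>. bilin \<beta> \<longrightarrow> sw x \<beta> = (\<Sum>(x, y)\<leftarrow>ts. \<beta> x y) + (\<Sum>(x, y)\<leftarrow>us. \<beta> x y))}"
  have D: "subspace ?D"
  proof (rule subspaceI)
    show "0 \<in> ?D"
      by (intro CollectI exI[of _ "[]"]) (simp add: lin_0[OF lin_sw_arg[OF _ lin_id]])
    show "x + y \<in> ?D" if "x \<in> ?D" "y \<in> ?D" for x y
    proof -
      from that obtain ts us ts' us' where "set ts \<subseteq> ?I \<times> UNIV" "set us \<subseteq> UNIV \<times> ?I"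
        "\<forall>\<beta>. bilin \<beta> \<longrightarrow> sw x \<beta> = (\<Sum>(x, y)\<leftarrow>ts. \<beta> x y) + (\<Sum>(x, y)\<leftarrow>us. \<beta> x y)"
        "set ts' \<subseteq> ?I \<times> UNIV" "set us' \<subseteq> UNIV \<times> ?I"
        "\<forall>\<beta>. bilin \<beta> \<longrightarrow> sw y \<beta> = (\<Sum>(x, y)\<leftarrow>ts'. \<beta> x y) + (\<Sum>(x, y)\<leftarrow>us'. \<beta> x y)"
        by blast
      then show ?thesis
        by (intro CollectI exI[of _ "ts @ ts'"] exI[of _ "us @ us'"]) (auto simp: sw_add_arg)
    qed
    show "scale c x \<in> ?D" if "x \<in> ?D" for c x
    proof -
      let ?m = "map (\<lambda>(x, y). (scale c x, y))"
      from that obtain ts us where tu: "set ts \<subseteq> ?I \<times> UNIV" "set us \<subseteq> UNIV \<times> ?I"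
        "\<And>\<beta>. bilin \<beta> \<Longrightarrow> sw x \<beta> = (\<Sum>(x, y)\<leftarrow>ts. \<beta> x y) + (\<Sum>(x, y)\<leftarrow>us. \<beta> x y)"
        by blast
      have "sw (scale c x) \<beta> = (\<Sum>(x, y)\<leftarrow>?m ts. \<beta> x y) + (\<Sum>(x, y)\<leftarrow>?m us. \<beta> x y)"
        if \<beta>: "bilin \<beta>" for \<beta>
        by (simp add: sw_scale_arg[OF \<beta>] tu(3)[OF \<beta>] case_prod_unfold comp_def scale_right_distrib
            lin_scale[OF bilin_left[OF \<beta>]] lin_sum_list[OF lin_scale_right[OF lin_id]])
      moreover have "set (?m ts) \<subseteq> ?I \<times> UNIV" "set (?m us) \<subseteq> UNIV \<times> ?I"
        using tu(1,2) subspace_scale[OF I] by auto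
      ultimately show ?thesis by blast
    qed
  qed
  have comult: "x \<in> ?D" if "x \<in> ?I" for x
  proof (rule ind[OF that lin_id D])
    fix h n assume n: "n \<in> A" "counit n = 0"
    obtain ts where ts: "set ts \<subseteq> UNIV \<times> A" "\<And>\<beta>. bilin \<beta> \<Longrightarrow>
      sw n \<beta> = (\<Sum>(x, y)\<leftarrow>ts. \<beta> x (y - scale (counit y) 1)) + \<beta> n 1"
      using split[OF n(1)] by blast
    let ?ts = "[(h1 * n, h2). (h1, h2) \<leftarrow> comult h]"
    let ?us = "[(h1 * x, h2 * (y - scale (counit y) 1)). (h1, h2) \<leftarrow> comult h, (x, y) \<leftarrow> ts]"
    have "sw (h * n) \<beta> = (\<Sum>(x, y)\<leftarrow>?ts. \<beta> x y) + (\<Sum>(x, y)\<leftarrow>?us. \<beta> x y)" if \<beta>: "bilin \<beta>" for \<beta>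
    proof -
      note \<beta>' = lin_comp[OF bilin_left[OF \<beta>]] lin_comp[OF bilin_right[OF \<beta>]]
      have b: "bilin (\<lambda>x y. \<beta> (h1 * x) (h2 * y))" for h1 h2 by (intro multilin \<beta>')
      have "sw (h * n) \<beta> = sw h (\<lambda>h1 h2.
        (\<Sum>(x, y)\<leftarrow>ts. \<beta> (h1 * x) (h2 * (y - scale (counit y) 1))) + \<beta> (h1 * n) h2)"
        by (simp add: sw_mult[OF \<beta>] ts(2)[OF b])
      also have "\<dots> = (\<Sum>(x, y)\<leftarrow>?ts. \<beta> x y) + (\<Sum>(x, y)\<leftarrow>?us. \<beta> x y)"
        by (simp add: sw_def case_prod_unfold comp_def sum_list_addf sum_list_concat_map)
      finally show ?thesis .
    qed
    moreover have "set ?ts \<subseteq> ?I \<times> UNIV" using gen n by auto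
    moreover have "set ?us \<subseteq> UNIV \<times> ?I" using gen plus ts(1) by fastforce
    ultimately show "h * n \<in> ?D" by blast
  qed
  have antipode: "S x \<in> ?I" if "x \<in> ?I" for x
  proof (rule ind[OF that lin_S[OF lin_id] I])
    fix h n assume n: "n \<in> A" "counit n = 0"
    obtain ts where ts: "set ts \<subseteq> UNIV \<times> A" "\<And>\<beta>. bilin \<beta> \<Longrightarrow>
      sw n \<beta> = (\<Sum>(x, y)\<leftarrow>ts. \<beta> x (y - scale (counit y) 1)) + \<beta> n 1"
      using split[OF n(1)] by blast
    have "bilin (\<lambda>x y. S x * y)" by (intro multilin)
    from ts(2)[OF this] have "S n = - (\<Sum>(x, y)\<leftarrow>ts. S x * (y - scale (counit y) 1))"
      by (simp add: sw_S_left' n eq_neg_iff_add_eq_0 add.commute)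
    moreover have "(\<Sum>(x, y)\<leftarrow>ts. S x * (y - scale (counit y) 1)) \<in> ?I"
      using ts(1) by (induct ts) (auto intro!: subspace_0[OF I] subspace_add[OF I] gen plus)
    ultimately have "S n \<in> ?I" by (simp add: subspace_neg[OF I])
    then show "S (h * n) \<in> ?I" by (simp add: S_mult right)
  qed
  have "ideal ?I underlying_ring"
  proof (rule idealI)
    show "ring (underlying_ring :: 'h ring)"
      unfolding underlying_ring_def
      by (intro ringI abelian_groupI monoidI)
        (auto simp: algebra_simps intro: exI[of _ "- x" for x])
    have inv: "inv\<^bsub>add_monoid (underlying_ring :: 'h ring)\<^esub> x = - x" for x
      by (rule group.inv_equality[OF abelian_group.a_group])
        (auto simp: underlying_ring_def intro!: abelian_groupI exI[of _ "- x" for x])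
    show "subgroup ?I (add_monoid (underlying_ring :: 'h ring))"
    proof (rule subgroup.intro)
      show "inv\<^bsub>add_monoid (underlying_ring :: 'h ring)\<^esub> x \<in> ?I" if "x \<in> ?I" for x
        unfolding inv using that by (rule subspace_neg[OF I])
    qed (auto simp: subspace_add[OF I] subspace_0[OF I] underlying_ring_def)
  qed (auto simp: underlying_ring_def left right)
  moreover have "\<exists>ts us. set ts \<subseteq> ?I \<times> UNIV \<and> set us \<subseteq> UNIV \<times> ?I \<and> tensor_eq (comult x) (ts @ us)"
    if x: "x \<in> ?I" for x
  proof -
    obtain ts us where tu: "set ts \<subseteq> ?I \<times> UNIV" "set us \<subseteq> UNIV \<times> ?I"
      "\<And>\<beta>. bilin \<beta> \<Longrightarrow> sw x \<beta> = (\<Sum>(x, y)\<leftarrow>ts. \<beta> x y) + (\<Sum>(x, y)\<leftarrow>us. \<beta> x y)"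
      using comult[OF x] by blast
    have "tensor_eq (comult x) (ts @ us)"
      by (rule tensor_eqI[of 1]) (use tu(3) in \<open>auto simp: sw_def\<close>)
    with tu(1,2) show ?thesis by blast
  qed
  ultimately show ?thesis
    unfolding hopf_ideal_def using I counit antipode by blast
qed

text \<open>
  Modulo \<open>I\<close>, replacing \<open>{a\<^sub>1, b\<^sub>1}g\<close> by \<open>\<epsilon>(a\<^sub>1)\<epsilon>(b\<^sub>1)1\<close> in \<open>{a\<^sub>1, b\<^sub>1} g S\<^sup>-\<^sup>2(b\<^sub>2)a\<^sub>2 = aS\<^sup>2(b)\<close> gives
  \<open>S\<^sup>-\<^sup>2(b)a\<close>, and \<open>S\<^sup>-\<^sup>2(b)\<close> may be replaced by \<open>S\<^sup>2(b)\<close> because \<open>gS\<^sup>-\<^sup>2(b) = S\<^sup>2(b)g\<close> and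
  \<open>g - 1 \<in> N\<^sup>+\<close>. Every element of \<open>H\<close> has the form \<open>S\<^sup>2(b)\<close>.
\<close>

lemma commute_mod_left_ideal_plus:
  "a * c - c * a \<in> left_ideal_plus (commutator_subalgebra g)"
proof -
  let ?N = "commutator_subalgebra g"
  let ?I = "left_ideal_plus ?N"
  have hopf: "hopf_ideal ?I"
    by (rule hopf_ideal_left_ideal_plus[OF normal_commutator_subalgebra])
  then interpret I: ideal ?I underlying_ring by (simp add: hopf_ideal_def)
  have sub: "subspace ?I" using hopf by (simp add: hopf_ideal_def)
  have left: "h * x \<in> ?I" and right: "x * h \<in> ?I" if "x \<in> ?I" for h x
    using that I.I_l_closed[of x h] I.I_r_closed[of x h] by (simp_all add: underlying_ring_def)
  have N: "subspace ?N" "1 \<in> ?N"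
    using subalgebra_commutator_subalgebra by (auto simp: subalgebra_def)
  have plus: "x - scale (counit x) 1 \<in> ?I" if "x \<in> ?N" for x
  proof -
    have "x - scale (counit x) 1 \<in> ?N" "counit (x - scale (counit x) 1) = 0"
      using that N by (simp_all add: subspace_diff subspace_scale counit_diff counit_scale counit_one)
    then have "1 * (x - scale (counit x) 1) \<in> ?I"
      unfolding left_ideal_plus_def by (intro span_base) blast
    then show ?thesis by simp
  qed
  define b where "b = T (T c)"
  let ?W = "\<lambda>a b. com a b * g"
  have W: "?W a b - scale (counit a) (scale (counit b) 1) \<in> ?I" for a b
  proof -
    have "?W a b - scale (counit a) (scale (counit b) 1)
      = (com a b - scale (counit (com a b)) 1) * g + scale (counit (com a b)) (g - scale (counit g) 1)"
      by (simp add: counit_com counit_g left_diff_distrib scale_right_diff_distrib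
          scale_mult_left[symmetric])
    also have "\<dots> \<in> ?I"
      by (intro subspace_add[OF sub] subspace_scale[OF sub] right plus com_in g_in)
    finally show ?thesis .
  qed
  have 1: "sw a (\<lambda>a' a3. sw b (\<lambda>b' b3. ?W a' b' * (T (T b3) * a3))) = a * S (S b)"
  proof -
    have "sw a (\<lambda>a' a3. sw b (\<lambda>b' b3. ?W a' b' * (T (T b3) * a3)))
      = sw a (\<lambda>a' a3. sw b (\<lambda>b' b3. sw a' (\<lambda>a1 a2. sw b' (\<lambda>b1 b2.
          a1 * (S (S b1) * (S a2 * (T b2 * (T (T b3) * a3))))))))"
      by (simp add: com_def sw_pull_right[symmetric] mult.assoc G_g')
    also have "\<dots> = sw a (\<lambda>a' a3. sw a' (\<lambda>a1 a2. sw b (\<lambda>b' b3. sw b' (\<lambda>b1 b2.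
          a1 * (S (S b1) * (S a2 * (T b2 * (T (T b3) * a3))))))))"
      by (rule sw_cong, rule sw_swap)
    also have "\<dots> = sw a (\<lambda>a1 t. sw t (\<lambda>a2 a3. sw b (\<lambda>b1 t'. sw t' (\<lambda>b2 b3.
          a1 * (S (S b1) * (S a2 * (T b2 * (T (T b3) * a3))))))))"
      by (simp add: sw_assoc multilinT)
    also have "\<dots> = sw a (\<lambda>a1 t. sw t (\<lambda>a2 a3. sw b (\<lambda>b1 t'. scale (counit t')
          (a1 * (S (S b1) * (S a2 * a3))))))"
      by (simp add: sw_pull_left sw_TT scale_mult_right[symmetric])
    also have "\<dots> = a * S (S b)"
      by (simp add: sw_counit_right multilinT cancel)
    finally show ?thesis .
  qed
  have 2: "sw a (\<lambda>a' a3. sw b (\<lambda>b' b3. scale (counit a') (scale (counit b') 1) * (T (T b3) * a3)))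
      = T (T b) * a"
    by (simp add: scale_mult_left[symmetric] sw_pull_scale sw_counit_left multilinT del: scale_scale)
  have "a * S (S b) - T (T b) * a = sw a (\<lambda>a' a3. sw b (\<lambda>b' b3.
      (?W a' b' - scale (counit a') (scale (counit b') 1)) * (T (T b3) * a3)))"
    by (simp only: 1[symmetric] 2[symmetric] sw_diff[symmetric] left_diff_distrib)
  also have "\<dots> \<in> ?I" by (intro sw_in_subspace sub right W)
  finally have "a * S (S b) - T (T b) * a \<in> ?I" .
  moreover have "T (T b) * a - S (S b) * a \<in> ?I"
  proof -
    have "T (T b) - S (S b) = S (S b) * (g - scale (counit g) 1) - (g - scale (counit g) 1) * T (T b)"
      using S4[of "T (T b)"] by (simp add: S_T counit_g algebra_simps)
    also have "\<dots> \<in> ?I" by (intro subspace_diff[OF sub] left right plus g_in)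
    finally show ?thesis using right[of "T (T b) - S (S b)" a] by (simp add: left_diff_distrib)
  qed
  ultimately have "(a * S (S b) - T (T b) * a) + (T (T b) * a - S (S b) * a) \<in> ?I"
    by (rule subspace_add[OF sub])
  then show ?thesis by (simp add: b_def S_T)
qed

end

theorem proposition3p4:
  fixes scale :: "'k::field \<Rightarrow> 'h::ring_1 \<Rightarrow> 'h"
    and comult :: "'h \<Rightarrow> ('h \<times> 'h) list"
    and counit :: "'h \<Rightarrow> 'k"
    and antipode :: "'h \<Rightarrow> 'h"
    and g :: 'h
    and N I :: "'h set"
  assumes "hopf_algebra scale comult counit antipode"
    and "hopf_algebra.finite_dimensional scale"
    and "hopf_algebra.unimodular scale counit"
    and "hopf_algebra.distinguished_grouplike scale comult g"
    and "N = hopf_algebra.commutator_subalgebra scale comult antipode g"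
    and "I = hopf_algebra.left_ideal_plus scale counit N"
  shows "hopf_algebra.normal_left_coideal_subalgebra scale comult antipode N \<and>
         hopf_algebra.hopf_ideal scale comult counit antipode I \<and>
         cring (hopf_algebra.underlying_ring Quot I)"
proof -
  interpret hopf_algebra scale comult counit antipode by fact
  obtain l where "dual_right_integral l" "\<exists>a. l a \<noteq> 0"
    "\<And>a. (\<Sum>(x, y)\<leftarrow>comult a. scale (l y) x) = scale (l a) g"
    using assms(4) unfolding distinguished_grouplike_def by blast
  with assms(2,3) interpret unimodular_hopf_algebra scale comult counit antipode l g
    by unfold_locales
  have hopf: "hopf_ideal I"
    unfolding assms(5,6) by (rule hopf_ideal_left_ideal_plus[OF normal_commutator_subalgebra])
  then interpret I: ideal I underlying_ring by (simp add: hopf_ideal_def)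
  have R: "carrier (underlying_ring :: 'h ring) = UNIV"
    "\<And>x y :: 'h. x \<otimes>\<^bsub>underlying_ring\<^esub> y = x * y"
    by (simp_all add: underlying_ring_def)
  have "x \<otimes>\<^bsub>underlying_ring Quot I\<^esub> y = y \<otimes>\<^bsub>underlying_ring Quot I\<^esub> x"
    if "x \<in> carrier (underlying_ring Quot I)" "y \<in> carrier (underlying_ring Quot I)" for x y
  proof -
    have "\<exists>a. x = I +>\<^bsub>underlying_ring\<^esub> a" if "x \<in> carrier (underlying_ring Quot I)" for x
      using that by (auto simp: FactRing_def A_RCOSETS_defs a_r_coset_def)
    then obtain a c where x: "x = I +>\<^bsub>underlying_ring\<^esub> a" and y: "y = I +>\<^bsub>underlying_ring\<^esub> c"
      using \<open>x \<in> _\<close> \<open>y \<in> _\<close> by meson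
    have "a * c - c * a \<in> I"
      unfolding assms(5,6) by (rule commute_mod_left_ideal_plus)
    then have "a * c \<in> I +>\<^bsub>underlying_ring\<^esub> (c * a)"
      by (auto simp: a_r_coset_def' underlying_ring_def intro!: bexI[of _ "a * c - c * a"])
    then have "I +>\<^bsub>underlying_ring\<^esub> (c * a) = I +>\<^bsub>underlying_ring\<^esub> (a * c)"
      using I.a_subgroup by (intro I.a_repr_independence) (auto simp: underlying_ring_def)
    then show ?thesis
      unfolding x y by (simp add: FactRing_def I.rcoset_mult_add R)
  qed
  then have "cring (underlying_ring Quot I)"
    using I.quotient_is_ring
    by (intro cring.intro monoid.monoid_comm_monoidI ring.is_monoid) auto
  with hopf normal_commutator_subalgebra show ?thesis by (simp add: assms(5))
qed

end
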